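(* Let $G$ be a finitely generated torsion-free nilpotent group. Then there exists $m$ such that $G$ admits an essentially free (orientation-preserving) affine action on $\mathbb{Z}^m$, where $\mathbb{Z}^m$ carries the lexicographic order.
   Context: An ordered abelian group $\Lambda$ is an additively written abelian group with a translation-invariant linear order; $\mathrm{Aut}^+(\Lambda)$ is the group of order-preserving group automorphisms of $\Lambda$. $\Lambda$ is viewed as a $\Lambda$-metric space (a "linear $\Lambda$-tree") via $d(x,y)=|x-y|=\max\{x-y,y-x\}$. Given a group $G$ and a homomorphism $\alpha:G\to\mathrm{Aut}^+(\Lambda)$, $g\mapsto\alpha_g$, an $\alpha$-affine action of $G$ on $\Lambda$ is an action of $G$ on the set $\Lambda$ with $d(gx,gy)=\alpha_g d(x,y)$ for all $x,y\in\Lambda$, $g\in G$. An affine action is an $\alpha$-affine action for some $\alpha$. All affine actions on $\Lambda$ are assumed to be orientation-preserving, i.e. $x\le y\Rightarrow gx\le gy$ (equivalently, each $g$ acts as $x\mapsto \alpha_g x+\nu_g$ for some $\nu_g\in\Lambda$). An orientation-preserving affine automorphism $g$ of $\Lambda$ is hyperbolic if it fixes no point of $\Lambda$, and rigid if no segment $[\lambda_1,\lambda_2]=\{\mu:\lambda_1\le\mu\le\lambda_2\}$ is mapped properly into itself by $g$ or $g^{-1}$; equivalently, if $g^{\epsilon}\lambda>\lambda$ for some $\lambda\in\Lambda$ and $\epsilon=\pm1$, then $g^{\epsilon}\lambda'>\lambda'$ for all $\lambda'\in\Lambda$. An affine action of $G$ on $\Lambda$ is essentially free if every non-trivial $g\in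 G$ acts as a rigid and hyperbolic automorphism. *)

theory Defs
  imports "HOL-Algebra.Algebra" "HOL-Library.Fun_Lexorder"
begin

section \<open>Finitely generated, torsion-free and nilpotent groups\<close>

definition finitely_generated_group :: "('a, 'b) monoid_scheme \<Rightarrow> bool"
  where "finitely_generated_group G \<longleftrightarrow>
    group G \<and> (\<exists>S \<subseteq> carrier G. finite S \<and> generate G S = carrier G)"

definition torsion_free_group :: "('a, 'b) monoid_scheme \<Rightarrow> bool"
  where "torsion_free_group G \<longleftrightarrow>
    group G \<and> (\<forall>x \<in> carrier G. \<forall>n::nat. n > 0 \<longrightarrow> x [^]\<^bsub>G\<^esub> n = \<one>\<^bsub>G\<^esub> \<longrightarrow> x = \<one>\<^bsub>G\<^esub>)"

text \<open>The indexing starts at 0, so that \<open>lower_central G c\<close> is the term usually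
  written \<open>\<gamma>\<^sub>c\<^sub>+\<^sub>1(G)\<close>.\<close>

primrec lower_central :: "('a, 'b) monoid_scheme \<Rightarrow> nat \<Rightarrow> 'a set"
  where
    "lower_central G 0 = carrier G"
  | "lower_central G (Suc n) = generate G
      {x \<otimes>\<^bsub>G\<^esub> y \<otimes>\<^bsub>G\<^esub> inv\<^bsub>G\<^esub> x \<otimes>\<^bsub>G\<^esub> inv\<^bsub>G\<^esub> y | x y. x \<in> lower_central G n \<and> y \<in> carrier G}"

definition nilpotent_group :: "('a, 'b) monoid_scheme \<Rightarrow> bool"
  where "nilpotent_group G \<longleftrightarrow> group G \<and> (\<exists>c. lower_central G c = {\<one>\<^bsub>G\<^esub>})"


section \<open>Ordered abelian groups\<close>

text \<open>The group operation is written multiplicatively, as everywhere in HOL-Algebra: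
  \<open>x \<otimes> inv y\<close> is the difference \<open>x - y\<close>.\<close>

locale ordered_comm_group = comm_group L for L (structure) +
  fixes leq :: "'a \<Rightarrow> 'a \<Rightarrow> bool"  (infix \<open>\<preceq>\<close> 50)
  assumes le_refl: "x \<in> carrier L \<Longrightarrow> x \<preceq> x"
    and le_antisym: "\<lbrakk>x \<in> carrier L; y \<in> carrier L; x \<preceq> y; y \<preceq> x\<rbrakk> \<Longrightarrow> x = y"
    and le_trans: "\<lbrakk>x \<in> carrier L; y \<in> carrier L; z \<in> carrier L; x \<preceq> y; y \<preceq> z\<rbrakk> \<Longrightarrow> x \<preceq> z"
    and le_total: "\<lbrakk>x \<in> carrier L; y \<in> carrier L\<rbrakk> \<Longrightarrow> x \<preceq> y \<or> y \<preceq> x"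
    and le_translate: "\<lbrakk>x \<in> carrier L; y \<in> carrier L; z \<in> carrier L; x \<preceq> y\<rbrakk> \<Longrightarrow> x \<otimes> z \<preceq> y \<otimes> z"

definition order_preserving_on :: "'a set \<Rightarrow> ('a \<Rightarrow> 'a \<Rightarrow> bool) \<Rightarrow> ('a \<Rightarrow> 'a) \<Rightarrow> bool"
  where "order_preserving_on E leq f \<longleftrightarrow> (\<forall>x \<in> E. \<forall>y \<in> E. leq x y \<longrightarrow> leq (f x) (f y))"

text \<open>As the order is linear, the inverse of an order-preserving automorphism preserves
  the order as well.\<close>

definition OrdAutoGroup ::
    "('a, 'c) monoid_scheme \<Rightarrow> ('a \<Rightarrow> 'a \<Rightarrow> bool) \<Rightarrow> ('a \<Rightarrow> 'a) monoid"
  where "OrdAutoGroup L leq =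
    AutoGroup L \<lparr>carrier := {f \<in> auto L. order_preserving_on (carrier L) leq f}\<rparr>"

definition ord_dist :: "('a, 'c) monoid_scheme \<Rightarrow> ('a \<Rightarrow> 'a \<Rightarrow> bool) \<Rightarrow> 'a \<Rightarrow> 'a \<Rightarrow> 'a"
  where "ord_dist L leq x y =
    (let u = x \<otimes>\<^bsub>L\<^esub> inv\<^bsub>L\<^esub> y; v = y \<otimes>\<^bsub>L\<^esub> inv\<^bsub>L\<^esub> x in if leq u v then v else u)"

definition segment :: "'a set \<Rightarrow> ('a \<Rightarrow> 'a \<Rightarrow> bool) \<Rightarrow> 'a \<Rightarrow> 'a \<Rightarrow> 'a set"
  where "segment E leq a b = {x \<in> E. leq a x \<and> leq x b}"


section \<open>Affine actions\<close>

locale alpha_affine_action =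
  ordered_comm_group L leq + group_action G "carrier L" \<phi>
  for G :: "('g, 'b) monoid_scheme" and L :: "('a, 'c) monoid_scheme"
    and leq :: "'a \<Rightarrow> 'a \<Rightarrow> bool" and \<phi> :: "'g \<Rightarrow> 'a \<Rightarrow> 'a" +
  fixes \<alpha> :: "'g \<Rightarrow> 'a \<Rightarrow> 'a"
  assumes alpha_hom: "\<alpha> \<in> hom G (OrdAutoGroup L leq)"
    and dist_scaled: "\<lbrakk>g \<in> carrier G; x \<in> carrier L; y \<in> carrier L\<rbrakk> \<Longrightarrow>
      ord_dist L leq (\<phi> g x) (\<phi> g y) = \<alpha> g (ord_dist L leq x y)"

definition affine_action ::
    "('g, 'b) monoid_scheme \<Rightarrow> ('a, 'c) monoid_scheme \<Rightarrow> ('a \<Rightarrow> 'a \<Rightarrow> bool) \<Rightarrow> ('g \<Rightarrow> 'a \<Rightarrow> 'a) \<Rightarrow> bool"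
  where "affine_action G L leq \<phi> \<longleftrightarrow> (\<exists>\<alpha>. alpha_affine_action G L leq \<phi> \<alpha>)"

definition orientation_preserving_action ::
    "('g, 'b) monoid_scheme \<Rightarrow> ('a, 'c) monoid_scheme \<Rightarrow> ('a \<Rightarrow> 'a \<Rightarrow> bool) \<Rightarrow> ('g \<Rightarrow> 'a \<Rightarrow> 'a) \<Rightarrow> bool"
  where "orientation_preserving_action G L leq \<phi> \<longleftrightarrow>
    (\<forall>g \<in> carrier G. order_preserving_on (carrier L) leq (\<phi> g))"

definition hyperbolic_on :: "'a set \<Rightarrow> ('a \<Rightarrow> 'a) \<Rightarrow> bool"
  where "hyperbolic_on E f \<longleftrightarrow> (\<forall>x \<in> E. f x \<noteq> x)"

definition rigid_on :: "'a set \<Rightarrow> ('a \<Rightarrow> 'a \<Rightarrow> bool) \<Rightarrow> ('a \<Rightarrow> 'a) \<Rightarrow> bool"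
  where "rigid_on E leq f \<longleftrightarrow>
    (\<forall>a \<in> E. \<forall>b \<in> E. \<not> f ` segment E leq a b \<subset> segment E leq a b
      \<and> \<not> (inv\<^bsub>BijGroup E\<^esub> f) ` segment E leq a b \<subset> segment E leq a b)"

definition essentially_free_action ::
    "('g, 'b) monoid_scheme \<Rightarrow> ('a, 'c) monoid_scheme \<Rightarrow> ('a \<Rightarrow> 'a \<Rightarrow> bool) \<Rightarrow> ('g \<Rightarrow> 'a \<Rightarrow> 'a) \<Rightarrow> bool"
  where "essentially_free_action G L leq \<phi> \<longleftrightarrow>
    (\<forall>g \<in> carrier G. g \<noteq> \<one>\<^bsub>G\<^esub> \<longrightarrow> rigid_on (carrier L) leq (\<phi> g) \<and> hyperbolic_on (carrier L) (\<phi> g))"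


section \<open>The group of integer m-tuples with the lexicographic order\<close>

definition int_tuple_group :: "nat \<Rightarrow> (nat \<Rightarrow> int) monoid"
  where "int_tuple_group m = product_group {..<m} (\<lambda>_. integer_group)"

text \<open>The coordinate with index 0 is the most significant one. Elements of
  \<open>carrier (int_tuple_group m)\<close> all take the same value outside \<open>{..<m}\<close>, so that only the
  first \<open>m\<close> coordinates matter in \<open>less_fun\<close>.\<close>

definition lex_le :: "(nat \<Rightarrow> int) \<Rightarrow> (nat \<Rightarrow> int) \<Rightarrow> bool"
  where "lex_le x y \<longleftrightarrow> x = y \<or> less_fun x y"

lemma ordered_comm_group_int_tuple_group: "ordered_comm_group (int_tuple_group m) lex_le"
proof -
  have grp: "group (int_tuple_group m)"
    by (simp add: int_tuple_group_def)
  have carr: "carrier (int_tuple_group m) = {..<m} \<rightarrow>\<^sub>E UNIV"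
    by (simp add: int_tuple_group_def)
  have mult: "x \<otimes>\<^bsub>int_tuple_group m\<^esub> y = (\<lambda>i\<in>{..<m}. x i + y i)" for x y
    by (simp add: int_tuple_group_def)
  interpret comm_group "int_tuple_group m"
    by (rule group.group_comm_groupI[OF grp]) (simp add: mult add.commute)
  show ?thesis
  proof
    fix x y assume "lex_le x y" "lex_le y x"
    then show "x = y"
      using less_fun_asym unfolding lex_le_def by blast
  next
    fix x y z assume "lex_le x y" "lex_le y z"
    then show "lex_le x z"
      using less_fun_trans unfolding lex_le_def by blast
  next
    fix x y assume xy: "x \<in> carrier (int_tuple_group m)" "y \<in> carrier (int_tuple_group m)"
    have "finite {k. x k \<noteq> y k}"
      by (rule finite_subset[of _ "{..<m}"]) (use xy in \<open>auto simp: carr PiE_def extensional_def\<close>)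
    then show "lex_le x y \<or> lex_le y x"
      using less_fun_trichotomy unfolding lex_le_def by blast
  next
    fix x y z assume xy: "x \<in> carrier (int_tuple_group m)" "y \<in> carrier (int_tuple_group m)"
      and "lex_le x y"
    then consider "x = y" | k where "x k < y k" "\<And>j. j < k \<Longrightarrow> x j = y j"
      unfolding lex_le_def less_fun_def by blast
    then show "lex_le (x \<otimes>\<^bsub>int_tuple_group m\<^esub> z) (y \<otimes>\<^bsub>int_tuple_group m\<^esub> z)"
    proof cases
      case 2
      have "k < m"
        using 2(1) xy by (metis PiE_arb carr lessThan_iff less_irrefl)
      then show ?thesis
        unfolding lex_le_def less_fun_def using 2
        by (intro disjI2 exI[of _ k]) (simp add: mult)
    qed (simp add: lex_le_def)
  qed (simp add: lex_le_def)
qed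

end

theory Submission
  imports Defs
begin

text \<open>
  The idea is to let \<open>G\<close> act linearly on a space of integer-valued polynomials on \<open>G\<close> and to dualise.

  A function \<open>f\<close> from \<open>G\<close> to the integers is a polynomial of degree less than \<open>d\<close> if all its \<open>d\<close>-fold
  left differences vanish, a left difference being \<open>f (h \<otimes> x) - f x\<close> as a function of \<open>x\<close>. As \<open>G\<close> is finitely
  generated, these polynomials form a free abelian group of finite rank, and there is a basis
  \<open>b 0 = 1, b 1, \<dots>, b m\<close> ordered by degree (\<open>adapted_basis_exists\<close>). Right translations commute
  with left differences, so \<open>G\<close> acts on the polynomials by right translations, through
  unitriangular matrices. The dual action on the functionals with value 1 at \<open>b 0\<close>, read in the
  coordinates given by \<open>b 1, \<dots>, b m\<close>, is an affine action on integer tuples, and it preserves the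
  lexicographic order because its linear part is unitriangular.

  Why is it essentially free? Let \<open>b i\<close> be the first member of the basis that the translation by
  \<open>g\<close> does not fix, of degree \<open>j\<close> say. All polynomials of degree less than \<open>j\<close> are then fixed, in
  particular the left differences of \<open>b i\<close>. So the translation changes \<open>b i\<close> by a function with
  vanishing left differences, that is by a nonzero constant \<open>c\<close> (\<open>right_diff_constant\<close>,
  \<open>unitriangular_representation\<close>). On tuples this means that \<open>g\<close> keeps the coordinates before the
  one of \<open>b i\<close> and adds \<open>c\<close> to that one, whatever the tuple: every tuple is moved in the direction of
  the sign of \<open>c\<close>. Such a map is hyperbolic and rigid (\<open>rigid_and_hyperbolic_if_moves\<close>).

  What remains is that polynomials of bounded degree separate the points of \<open>G\<close>
  (\<open>polynomials_separate_points\<close>), so that every \<open>g \<noteq> \<one>\<close> moves some \<open>b i\<close>. Here the hypotheses on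
  \<open>G\<close> enter. A finitely generated nilpotent group is polycyclic (\<open>polycyclic_of_nilpotent\<close>), and if it
  is torsion-free then the factors can be taken infinite cyclic
  (\<open>poly_infinite_cyclic_of_polycyclic\<close>). So \<open>G\<close> is built from the trivial group by steps in which
  \<open>K\<close> is the semidirect product of \<open>N\<close> and an infinite cyclic group generated by \<open>t\<close>. A polynomial
  on \<open>N\<close>, extended to \<open>K\<close> so as to ignore the powers of \<open>t\<close>, is again a polynomial, because conjugation
  by \<open>t\<close> acts unipotently on the polynomials on \<open>N\<close> (\<open>weight_less_conj\<close>, \<open>deg_less_extend\<close>).
\<close>

section \<open>Commutators and the lower central series\<close>

context group
begin

lemma inv_mult_cancel [simp]:
  assumes "x \<in> carrier G" "y \<in> carrier G"
  shows "inv x \<otimes> (x \<otimes> y) = y" and "x \<otimes> (inv x \<otimes> y) = y"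
  using assms by (simp_all flip: m_assoc)

lemmas word_simps = m_assoc inv_mult_group

definition commutator :: "'a \<Rightarrow> 'a \<Rightarrow> 'a"
  where "commutator x y = x \<otimes> y \<otimes> inv x \<otimes> inv y"

lemma commutator_closed [simp, intro]:
  "\<lbrakk>x \<in> carrier G; y \<in> carrier G\<rbrakk> \<Longrightarrow> commutator x y \<in> carrier G"
  by (simp add: commutator_def)

lemma commutator_identities:
  assumes "x \<in> carrier G" "y \<in> carrier G"
  shows inv_commutator: "inv (commutator x y) = commutator y x"
    and conj_eq_commutator_mult: "x \<otimes> y \<otimes> inv x = commutator x y \<otimes> y"
    and commutator_inv_left: "commutator (inv x) y = inv x \<otimes> inv (commutator x y) \<otimes> x"
    and commutator_inv_right: "commutator x (inv y) = inv y \<otimes> inv (commutator x y) \<otimes> y"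
  using assms by (simp_all add: commutator_def word_simps)

lemma commutator_mult:
  assumes "x \<in> carrier G" "y \<in> carrier G" "z \<in> carrier G"
  shows commutator_mult_left: "commutator (x \<otimes> y) z = x \<otimes> commutator y z \<otimes> inv x \<otimes> commutator x z"
    and commutator_mult_right: "commutator x (y \<otimes> z) = commutator x y \<otimes> (y \<otimes> commutator x z \<otimes> inv y)"
  using assms by (simp_all add: commutator_def word_simps)

lemma lower_central_Suc:
  "lower_central G (Suc n) =
    generate G {commutator x y | x y. x \<in> lower_central G n \<and> y \<in> carrier G}"
  by (simp add: commutator_def)

declare lower_central.simps(2) [simp del]

lemma subgroup_lower_central: "subgroup (lower_central G n) G"
proof (induction n)
  case 0
  then show ?case by (simp add: subgroup_self)
next
  case (Suc n)
  then show ?case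
    unfolding lower_central_Suc
    by (intro generate_is_subgroup) (auto dest: subgroup.mem_carrier)
qed

lemmas lower_central_closed =
  subgroup.m_closed[OF subgroup_lower_central] subgroup.m_inv_closed[OF subgroup_lower_central]

lemma lower_central_carrier: "x \<in> lower_central G n \<Longrightarrow> x \<in> carrier G"
  using subgroup_lower_central subgroup.mem_carrier by metis

lemma commutator_lower_central:
  assumes "x \<in> lower_central G n" "y \<in> carrier G"
  shows "commutator x y \<in> lower_central G (Suc n)" and "commutator y x \<in> lower_central G (Suc n)"
proof -
  show *: "commutator x y \<in> lower_central G (Suc n)"
    unfolding lower_central_Suc using assms by (blast intro: generate.incl)
  show "commutator y x \<in> lower_central G (Suc n)"
    using subgroup.m_inv_closed[OF subgroup_lower_central *] assms lower_central_carrier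
    by (simp add: inv_commutator)
qed

lemma lower_central_Suc_subset: "lower_central G (Suc n) \<subseteq> lower_central G n"
proof (induction n)
  case 0
  then show ?case using lower_central_carrier by auto
next
  case (Suc n)
  have "{commutator x y |x y. x \<in> lower_central G (Suc n) \<and> y \<in> carrier G} \<subseteq> lower_central G (Suc n)"
    using Suc commutator_lower_central by blast
  then show ?case
    unfolding lower_central_Suc[of "Suc n"]
    by (rule generate_subgroup_incl) (rule subgroup_lower_central)
qed

lemma lower_central_antimono: "m \<le> n \<Longrightarrow> lower_central G n \<subseteq> lower_central G m"
  by (rule lift_Suc_antimono_le) (use lower_central_Suc_subset in auto)

section \<open>Finitely generated nilpotent groups are polycyclic\<close>

text \<open>Modulo \<open>lower_central G (Suc (Suc n))\<close> the commutator map is bimultiplicative on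
  \<open>lower_central G n \<times> G\<close> and trivial on \<open>lower_central G (Suc n) \<times> G\<close>. Hence the commutators
  of finitely many generators of the two factors generate the next quotient of the series.\<close>

lemma lower_central_finitely_generated_mod_Suc:
  assumes S: "finite S" "S \<subseteq> carrier G" "generate G S = carrier G"
  shows "\<exists>T. finite T \<and> T \<subseteq> lower_central G n \<and>
    lower_central G n \<subseteq> generate G (T \<union> lower_central G (Suc n))"
proof (induction n)
  case 0
  have "carrier G \<subseteq> generate G (S \<union> lower_central G (Suc 0))"
    using S(3) mono_generate[of S "S \<union> lower_central G (Suc 0)"] by auto
  then show ?case using S by auto
next
  case (Suc n)
  then obtain T where T: "finite T" "T \<subseteq> lower_central G n"
    "lower_central G n \<subseteq> generate G (T \<union> lower_central G (Suc n))" by blast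
  let ?U = "(\<lambda>(t, s). commutator t s) ` (T \<times> S)"
  define M where "M = generate G (?U \<union> lower_central G (Suc (Suc n)))"
  have U: "?U \<subseteq> lower_central G (Suc n)"
    using commutator_lower_central(1)[of _ n] T(2) S(2) by auto
  have UM: "?U \<subseteq> M" and LM: "lower_central G (Suc (Suc n)) \<subseteq> M"
    unfolding M_def by (auto intro: generate.incl)
  have M_sub: "subgroup M G"
    unfolding M_def using U lower_central_carrier by (intro generate_is_subgroup) blast
  have M_le: "M \<subseteq> lower_central G (Suc n)"
    unfolding M_def
    by (rule generate_subgroup_incl) (use U lower_central_Suc_subset subgroup_lower_central in auto)
  have conj: "g \<otimes> m \<otimes> inv g \<in> M" if "g \<in> carrier G" "m \<in> M" for g m
  proof -
    have "commutator g m \<in> M"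
      using commutator_lower_central(2)[of m "Suc n" g] that M_le LM by blast
    then show ?thesis
      using that M_sub by (metis conj_eq_commutator_mult subgroup.m_closed subgroup.mem_carrier)
  qed
  have conj': "inv g \<otimes> m \<otimes> g \<in> M" if "g \<in> carrier G" "m \<in> M" for g m
    using conj[of "inv g" m] that by simp
  have right: "commutator x y \<in> M" if x: "x \<in> T" and y: "y \<in> carrier G" for x y
  proof -
    have xc: "x \<in> carrier G" using x T(2) lower_central_carrier by blast
    have "y \<in> generate G S" using y S(3) by simp
    then show ?thesis
    proof (induction rule: generate.induct)
      case one
      then show ?case using xc M_sub by (simp add: commutator_def subgroup.one_closed)
    next
      case (incl h)
      then show ?case using x UM by auto
    next
      case (inv h)
      then have "commutator x h \<in> M" using x UM by auto
      then show ?case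
        using inv S(2) xc M_sub
        by (auto simp: commutator_inv_right intro!: conj' subgroup.m_inv_closed)
    next
      case (eng h1 h2)
      then have "h1 \<in> carrier G" "h2 \<in> carrier G"
        using S(2) generate_in_carrier by blast+
      with eng xc M_sub show ?case
        by (auto simp: commutator_mult_right intro!: conj subgroup.m_closed)
    qed
  qed
  have left: "commutator x y \<in> M" if x: "x \<in> lower_central G n" and y: "y \<in> carrier G" for x y
  proof -
    have *: "commutator h y \<in> M" if "h \<in> T \<union> lower_central G (Suc n)" for h
      using that right[OF _ y] commutator_lower_central(1)[OF _ y] LM by blast
    have sub: "T \<union> lower_central G (Suc n) \<subseteq> carrier G"
      using T(2) lower_central_carrier by blast
    have "x \<in> generate G (T \<union> lower_central G (Suc n))" using x T(3) by blast
    then show ?thesis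
    proof (induction rule: generate.induct)
      case one
      then show ?case using y M_sub by (simp add: commutator_def subgroup.one_closed)
    next
      case (incl h)
      then show ?case using * by auto
    next
      case (inv h)
      then have "h \<in> carrier G" using sub by blast
      then show ?case
        using *[OF inv] y M_sub
        by (auto simp: commutator_inv_left intro!: conj' subgroup.m_inv_closed)
    next
      case (eng h1 h2)
      then have "h1 \<in> carrier G" "h2 \<in> carrier G"
        using sub generate_in_carrier by blast+
      with eng y M_sub show ?case
        by (auto simp: commutator_mult_left intro!: conj subgroup.m_closed)
    qed
  qed
  have "lower_central G (Suc n) \<subseteq> M"
    unfolding lower_central_Suc[of n] by (rule generate_subgroup_incl) (use left M_sub in auto)
  then show ?case
    using U T(1) S(1) unfolding M_def by (intro exI[of _ ?U]) auto
qed

text \<open>The quotient \<open>K / H\<close> is cyclic, generated by the coset of \<open>a\<close>. That the commutators of \<open>K\<close>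
  lie in \<open>H\<close> says both that \<open>H\<close> is normal in \<open>K\<close> and that the quotient is abelian, without
  mentioning a quotient group.\<close>

inductive polycyclic :: "'a set \<Rightarrow> bool" where
  trivial: "polycyclic {\<one>}"
| cyclic_extension: "\<lbrakk>polycyclic H; subgroup H G; subgroup K G; H \<subseteq> K;
    \<And>x y. x \<in> K \<Longrightarrow> y \<in> K \<Longrightarrow> commutator x y \<in> H;
    a \<in> K; \<And>x. x \<in> K \<Longrightarrow> \<exists>k::int. a [^] k \<otimes> x \<in> H\<rbrakk> \<Longrightarrow> polycyclic K"

lemma swap_commutator:
  assumes "x \<in> carrier G" "y \<in> carrier G"
  shows "x \<otimes> y = commutator x y \<otimes> (y \<otimes> x)"
  using assms by (simp add: commutator_def word_simps)

lemma int_pow_mult_mod: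
  assumes H: "subgroup H G" and K: "subgroup K G"
    and comm: "\<And>x y. x \<in> K \<Longrightarrow> y \<in> K \<Longrightarrow> commutator x y \<in> H"
    and "H \<subseteq> K" "a \<in> K" "x \<in> K" "y \<in> K"
    and k: "a [^] (k::int) \<otimes> x \<in> H" and l: "a [^] (l::int) \<otimes> y \<in> H"
  shows "a [^] (l + k) \<otimes> (x \<otimes> y) \<in> H"
proof -
  have c: "x \<in> carrier G" "y \<in> carrier G" "a \<in> carrier G"
    using assms subgroup.mem_carrier[OF K] by auto
  have al: "a [^] l \<in> K"
    by (rule subgroup_int_pow_closed[OF K \<open>a \<in> K\<close>])
  have ax: "a [^] k \<otimes> x \<in> K" using k \<open>H \<subseteq> K\<close> by blast
  have "a [^] (l + k) \<otimes> (x \<otimes> y) = a [^] l \<otimes> (a [^] k \<otimes> x) \<otimes> y"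
    using c by (simp add: int_pow_mult m_assoc)
  also have "\<dots> = commutator (a [^] l) (a [^] k \<otimes> x) \<otimes> (a [^] k \<otimes> x \<otimes> a [^] l) \<otimes> y"
    using c by (subst swap_commutator) auto
  also have "\<dots> = commutator (a [^] l) (a [^] k \<otimes> x) \<otimes> ((a [^] k \<otimes> x) \<otimes> (a [^] l \<otimes> y))"
    using c by (simp add: m_assoc)
  also have "\<dots> \<in> H"
    using comm[OF al ax] k l by (auto intro!: subgroup.m_closed[OF H])
  finally show ?thesis .
qed

text \<open>As \<open>N / L\<close> is abelian, all subgroups between \<open>L\<close> and \<open>N\<close> are normal in \<open>N\<close>, so that the elements
  of \<open>T\<close> can be adjoined one at a time.\<close>

lemma polycyclic_adjoin_finite:
  assumes "finite T" "subgroup L G" "polycyclic L" "T \<subseteq> N" "L \<subseteq> N" "subgroup N G"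
    and comm: "\<And>x y. x \<in> N \<Longrightarrow> y \<in> N \<Longrightarrow> commutator x y \<in> L"
  shows "polycyclic (generate G (T \<union> L))"
  using assms(1,4)
proof (induction T)
  case empty
  have "generate G L = L"
    by (meson assms(2) generate_subgroup_incl generate.incl subset_antisym subset_iff)
  then show ?case using assms(3) by simp
next
  case (insert a T)
  let ?H = "generate G (T \<union> L)" and ?K = "generate G (insert a T \<union> L)"
  have Nc: "N \<subseteq> carrier G" using assms(6) subgroup.subset by blast
  have H: "subgroup ?H G" and K: "subgroup ?K G"
    using insert.prems assms(5) Nc by (auto intro!: generate_is_subgroup)
  have KN: "?K \<subseteq> N"
    by (rule generate_subgroup_incl) (use insert.prems assms(5,6) in auto)
  have HK: "?H \<subseteq> ?K" by (rule mono_generate) auto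
  have L: "L \<subseteq> ?H" by (auto intro: generate.incl)
  have a: "a \<in> carrier G" "a \<in> N" using insert.prems Nc by auto
  have "\<exists>k::int. a [^] k \<otimes> x \<in> ?H" if "x \<in> ?K" for x
    using that
  proof (induction rule: generate.induct)
    case one
    then show ?case using generate.one by (intro exI[of _ 0]) auto
  next
    case (incl h)
    show ?case
    proof (cases "h = a")
      case True
      then show ?thesis using generate.one a by (intro exI[of _ "-1"]) (auto simp: int_pow_neg)
    next
      case False
      then have "h \<in> ?H" using incl by (auto intro: generate.incl)
      then show ?thesis
        using subgroup.mem_carrier[OF H(1)] by (intro exI[of _ 0]) auto
    qed
  next
    case (inv h)
    show ?case
    proof (cases "h = a")
      case True
      then show ?thesis using generate.one a by (intro exI[of _ "1"]) auto
    next
      case False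
      then have "inv h \<in> ?H" using inv by (auto intro: generate.inv)
      then show ?thesis
        using subgroup.mem_carrier[OF H(1)] by (intro exI[of _ 0]) auto
    qed
  next
    case (eng x y)
    then obtain k l where "a [^] (k::int) \<otimes> x \<in> ?H" "a [^] (l::int) \<otimes> y \<in> ?H" by blast
    then show ?case
      using int_pow_mult_mod[OF H K _ HK, of a x y k l] eng.hyps KN comm L
        by (blast intro: generate.incl)
  qed
  moreover have "commutator x y \<in> ?H" if "x \<in> ?K" "y \<in> ?K" for x y
    using that KN comm L by blast
  moreover have "a \<in> ?K" by (auto intro: generate.incl)
  ultimately show ?case
    using insert.IH insert.prems H K HK
    by (intro cyclic_extension[of ?H ?K a]) auto
qed

lemma polycyclic_of_nilpotent:
  assumes S: "finite S" "S \<subseteq> carrier G" "generate G S = carrier G"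
    and nil: "lower_central G c = {\<one>}"
  shows "polycyclic (carrier G)"
proof -
  have "polycyclic (lower_central G (c - n))" if "n \<le> c" for n
    using that
  proof (induction n)
    case 0
    then show ?case using nil trivial by simp
  next
    case (Suc n)
    define k where "k = c - Suc n"
    have k: "c - n = Suc k" using Suc.prems by (simp add: k_def)
    obtain T where T: "finite T" "T \<subseteq> lower_central G k"
      "lower_central G k \<subseteq> generate G (T \<union> lower_central G (Suc k))"
      using lower_central_finitely_generated_mod_Suc[OF S] by blast
    have "polycyclic (generate G (T \<union> lower_central G (Suc k)))"
      by (rule polycyclic_adjoin_finite[where N = "lower_central G k"])
        (use T Suc k subgroup_lower_central lower_central_Suc_subset commutator_lower_central
          lower_central_carrier in auto)
    moreover have "generate G (T \<union> lower_central G (Suc k)) = lower_central G k"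
      using T generate_subgroup_incl[OF _ subgroup_lower_central, of "T \<union> lower_central G (Suc k)" k]
        lower_central_Suc_subset by blast
    ultimately show ?case by (simp add: k_def)
  qed
  from this[of c] show ?thesis by simp
qed

section \<open>Torsion-free nilpotent polycyclic groups are poly-infinite-cyclic\<close>

definition additive_on :: "'a set \<Rightarrow> ('a \<Rightarrow> int) \<Rightarrow> bool"
  where "additive_on K p \<longleftrightarrow> (\<forall>x\<in>K. \<forall>y\<in>K. p (x \<otimes> y) = p x + p y)"

lemma additive_onD: "\<lbrakk>additive_on K p; x \<in> K; y \<in> K\<rbrakk> \<Longrightarrow> p (x \<otimes> y) = p x + p y"
  by (simp add: additive_on_def)

lemma additive_on_basics:
  assumes K: "subgroup K G" and p: "additive_on K p"
  shows additive_on_one: "p \<one> = 0"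
    and additive_on_inv: "x \<in> K \<Longrightarrow> p (inv x) = - p x"
    and additive_on_nat_pow: "x \<in> K \<Longrightarrow> p (x [^] (n::nat)) = int n * p x"
    and additive_on_conj: "\<lbrakk>x \<in> K; y \<in> K\<rbrakk> \<Longrightarrow> p (x \<otimes> y \<otimes> inv x) = p y"
proof -
  note [simp] = subgroup.one_closed[OF K] subgroup.m_inv_closed[OF K] subgroup.m_closed[OF K]
    subgroup.mem_carrier[OF K] additive_onD[OF p]
  show one: "p \<one> = 0"
    using additive_onD[OF p, of \<one> \<one>] by simp
  show inv: "p (inv x) = - p x" if "x \<in> K" for x
    using additive_onD[OF p, of x "inv x"] that one by simp
  show "p (x [^] (n::nat)) = int n * p x" if "x \<in> K" for x
  proof (induction n)
    case (Suc n)
    have "x [^] n \<in> K" using that by (induction n) auto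
    then have "p (x [^] n \<otimes> x) = p (x [^] n) + p x"
      using that by (intro additive_onD[OF p])
    then show ?case unfolding nat_pow_Suc Suc by (simp only:) (simp add: algebra_simps)
  qed (simp add: one)
  show "p (x \<otimes> y \<otimes> inv x) = p y" if "x \<in> K" "y \<in> K" for x y
    using that by (simp add: inv)
qed

lemma additive_on_int_pow:
  assumes K: "subgroup K G" and p: "additive_on K p" and x: "x \<in> K"
  shows "p (x [^] (k::int)) = k * p x"
proof (cases k)
  case (nonneg n)
  then show ?thesis using additive_on_nat_pow[OF assms] by (simp add: int_pow_int)
next
  case (neg n)
  have "x [^] Suc n \<in> K"
    using subgroup_int_pow_closed[OF K x, of "int (Suc n)"] unfolding int_pow_int .
  then have "p (inv (x [^] Suc n)) = - (int (Suc n) * p x)"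
    by (simp only: additive_on_inv[OF K p] additive_on_nat_pow[OF assms])
  then show ?thesis
    unfolding neg int_pow_neg_int[OF subgroup.mem_carrier[OF K x]] by (simp only: mult_minus_left)
qed

lemma subgroup_additive_kernel:
  assumes K: "subgroup K G" and p: "additive_on K p"
  shows "subgroup {x \<in> K. p x = 0} G"
  using subgroup.subset[OF K] additive_on_one[OF assms] additive_on_inv[OF assms] additive_onD[OF p]
    subgroup.m_closed[OF K] subgroup.m_inv_closed[OF K] subgroup.one_closed[OF K]
  by (intro subgroup.intro) auto

text \<open>Infinite cyclic quotients are given by additive maps onto the integers, so that every
  extension splits: \<open>K\<close> is the semidirect product of the kernel of \<open>p\<close> and the powers of \<open>t\<close>.\<close>

inductive poly_infinite_cyclic :: "'a set \<Rightarrow> bool" where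
  trivial: "poly_infinite_cyclic {\<one>}"
| extension: "\<lbrakk>poly_infinite_cyclic {x \<in> K. p x = 0}; subgroup K G; additive_on K p; t \<in> K; p t = 1\<rbrakk>
    \<Longrightarrow> poly_infinite_cyclic K"

text \<open>The image of a nonzero additive map to the integers is generated by its least positive
  element; dividing by it makes the map surjective.\<close>

lemma poly_infinite_cyclic_of_additive:
  assumes K: "subgroup K G" and p: "additive_on K p"
    and N: "poly_infinite_cyclic {x \<in> K. p x = 0}"
  shows "poly_infinite_cyclic K"
proof (cases "\<exists>x\<in>K. p x \<noteq> 0")
  case False
  then have "{x \<in> K. p x = 0} = K" by auto
  then show ?thesis using N by simp
next
  case True
  then obtain x where x: "x \<in> K" "p x \<noteq> 0" by blast
  let ?P = "\<lambda>n. n > 0 \<and> (\<exists>x\<in>K. p x = int n)"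
  have "?P (nat \<bar>p x\<bar>)"
  proof (cases "p x > 0")
    case False
    then show ?thesis
      using x additive_on_inv[OF K p, of x] subgroup.m_inv_closed[OF K, of x] by force
  qed (use x in auto)
  then have e: "?P (LEAST n. ?P n)" by (rule LeastI)
  define e where "e = (LEAST n. ?P n)"
  obtain t where t: "t \<in> K" "p t = int e" and "e > 0" using e unfolding e_def by blast
  have dvd: "int e dvd p x" if "x \<in> K" for x
  proof -
    define y where "y = x \<otimes> t [^] (- (p x div int e))"
    have tk: "t [^] k \<in> K" for k :: int
      by (rule subgroup_int_pow_closed[OF K t(1)])
    have "y \<in> K" unfolding y_def using that tk subgroup.m_closed[OF K] by blast
    moreover have "p y = p x mod int e"
      using that tk additive_onD[OF p] additive_on_int_pow[OF K p t(1)] t(2)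
      by (simp add: y_def minus_div_mult_eq_mod[symmetric])
    moreover have "\<not> ?P (nat (p x mod int e))"
      using not_less_Least[of "nat (p x mod int e)" ?P] \<open>e > 0\<close>
      unfolding e_def[symmetric] by (simp add: nat_less_iff)
    ultimately have "p x mod int e = 0"
      using \<open>e > 0\<close> pos_mod_sign[of "int e" "p x"] by (cases "p x mod int e = 0") force+
    then show ?thesis by auto
  qed
  have "additive_on K (\<lambda>x. p x div int e)"
    using additive_onD[OF p] dvd by (simp add: additive_on_def div_plus_div_distrib_dvd_left)
  moreover have "p x div int e = 0 \<longleftrightarrow> p x = 0" if "x \<in> K" for x
    using dvd[OF that] by (metis div_0 dvd_div_eq_0_iff)
  then have "{x \<in> K. p x div int e = 0} = {x \<in> K. p x = 0}" by auto
  ultimately show ?thesis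
    using extension[of K "\<lambda>x. p x div int e" t] N K t \<open>e > 0\<close> by simp
qed

text \<open>The existence of homomorphisms to the integers hinges on this fact.
  Conjugation by \<open>x\<close> acts on the additive maps on \<open>H\<close> unipotently, because \<open>G\<close> is nilpotent,
  and with finite order, because \<open>x [^] r \<in> H\<close>. As the values are torsion-free the action is
  trivial. In the proof \<open>h\<close> runs down the lower central series: once the map vanishes on all
  \<open>[x, [x, h]]\<close>, its value on \<open>x [^] j \<otimes> h \<otimes> inv (x [^] j)\<close> is an affine function of \<open>j\<close>, and it
  takes the same value at \<open>0\<close> and \<open>r\<close>.\<close>

lemma additive_on_conj_invariant:
  assumes nil: "lower_central G c = {\<one>}"
    and H: "subgroup H G" and p: "additive_on H p"
    and x: "x \<in> carrier G" and conj: "\<And>h. h \<in> H \<Longrightarrow> x \<otimes> h \<otimes> inv x \<in> H"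
    and r: "r > 0" "x [^] (r::nat) \<in> H" and "h \<in> H"
  shows "p (x \<otimes> h \<otimes> inv x) = p h"
proof -
  have Hc: "h \<in> carrier G" if "h \<in> H" for h using that subgroup.mem_carrier[OF H] by auto
  have xH: "commutator x h \<in> H" if "h \<in> H" for h
    unfolding commutator_def
    by (intro subgroup.m_closed[OF H] subgroup.m_inv_closed[OF H] conj that)
  define \<delta> where "\<delta> h = p (commutator x h)" for h
  have \<delta>_add: "\<delta> (y \<otimes> z) = \<delta> y + \<delta> z" if "y \<in> H" "z \<in> H" for y z
  proof -
    have "y \<otimes> commutator x z \<otimes> inv y \<in> H"
      by (intro subgroup.m_closed[OF H] subgroup.m_inv_closed[OF H] xH that)
    then show ?thesis
      using that x xH Hc additive_on_conj[OF H p, of y "commutator x z"] additive_onD[OF p]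
      by (simp add: \<delta>_def commutator_mult_right)
  qed
  have p_conj: "p (x \<otimes> h \<otimes> inv x) = \<delta> h + p h" if "h \<in> H" for h
    using that x Hc xH additive_onD[OF p] by (simp add: conj_eq_commutator_mult \<delta>_def)
  have "\<delta> h = 0" if "k \<le> c" "h \<in> H" "h \<in> lower_central G (c - k)" for k h
    using that
  proof (induction k arbitrary: h)
    case 0
    then have "h = \<one>" using nil by simp
    then show ?case
      using x additive_on_one[OF H p] by (simp add: \<delta>_def commutator_def)
  next
    case (Suc k)
    define i where "i = c - Suc k"
    have i: "c - k = Suc i" using Suc.prems(1) by (simp add: i_def)
    have IH: "\<delta> y = 0" if "y \<in> H" "y \<in> lower_central G (Suc i)" for y
      using Suc.IH[of y] Suc.prems(1) that i by simp
    define u where "u j = x [^] j \<otimes> h \<otimes> inv (x [^] j)" for j :: nat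
    have u_Suc: "u (Suc j) = x \<otimes> u j \<otimes> inv x" for j
      using x Hc[OF Suc.prems(2)] by (simp only: u_def nat_pow_Suc2) (simp add: word_simps)
    have u: "u j \<in> H \<and> u j \<in> lower_central G i \<and> \<delta> (u j) = \<delta> h \<and> p (u j) = p h + int j * \<delta> h" for j
    proof (induction j)
      case 0
      then show ?case using Suc.prems Hc i_def by (simp add: u_def)
    next
      case (Suc j)
      then have uj: "u j \<in> H" "u j \<in> lower_central G i" by auto
      have eq: "u (Suc j) = commutator x (u j) \<otimes> u j"
        using u_Suc conj_eq_commutator_mult x Hc uj by simp
      have cl: "commutator x (u j) \<in> lower_central G (Suc i)"
        using commutator_lower_central(2) uj x by blast
      have "\<delta> (u (Suc j)) = \<delta> (u j)"
        using IH[OF xH[OF uj(1)] cl] \<delta>_add xH uj by (simp add: eq)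
      moreover have "u (Suc j) \<in> lower_central G i"
        unfolding eq using cl lower_central_Suc_subset[of i] uj(2)
        by (intro lower_central_closed(1)) auto
      moreover have "p (u (Suc j)) = \<delta> (u j) + p (u j)"
        using p_conj uj u_Suc by simp
      ultimately show ?case
        using Suc conj[OF uj(1)] u_Suc by (simp add: algebra_simps)
    qed
    have "p (u r) = p h"
      unfolding u_def using additive_on_conj[OF H p r(2) Suc.prems(2)] .
    then show ?case using u[of r] r(1) by simp
  qed
  from this[of c h] have "\<delta> h = 0" using \<open>h \<in> H\<close> Hc by simp
  then show ?thesis using p_conj \<open>h \<in> H\<close> by simp
qed

lemma nat_pow_mult_mod:
  assumes N: "subgroup N G" and K: "subgroup K G" and "N \<subseteq> K"
    and comm: "\<And>x y. x \<in> K \<Longrightarrow> y \<in> K \<Longrightarrow> commutator x y \<in> N"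
    and x: "x \<in> K" and y: "y \<in> K"
  shows "\<exists>c\<in>N. (x \<otimes> y) [^] (n::nat) = c \<otimes> (x [^] n \<otimes> y [^] n)"
proof (induction n)
  case 0
  then show ?case using subgroup.one_closed[OF N] by (intro bexI[of _ \<one>]) auto
next
  case (Suc n)
  then obtain c where c: "c \<in> N" "(x \<otimes> y) [^] n = c \<otimes> (x [^] n \<otimes> y [^] n)" by blast
  have pow: "z [^] n \<in> K" if "z \<in> K" for z
    using subgroup_int_pow_closed[OF K that, of "int n"] by (simp add: int_pow_int)
  define m where "m = commutator (y [^] n) x"
  have m: "m \<in> N" unfolding m_def using comm pow x y by blast
  have mem: "x \<in> carrier G" "y \<in> carrier G" "c \<in> carrier G" "m \<in> carrier G"
    using x y c(1) m \<open>N \<subseteq> K\<close> subgroup.mem_carrier[OF K] by auto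
  have c': "c \<otimes> (commutator (x [^] n) m \<otimes> m) \<in> N"
    using c(1) m comm[OF pow[OF x], of m] \<open>N \<subseteq> K\<close> subgroup.m_closed[OF N] by blast
  have "(x \<otimes> y) [^] Suc n = c \<otimes> (x [^] n \<otimes> (y [^] n \<otimes> x) \<otimes> y)"
    using mem by (simp add: c(2) m_assoc)
  also have "y [^] n \<otimes> x = m \<otimes> (x \<otimes> y [^] n)"
    unfolding m_def using mem by (intro swap_commutator) auto
  also have "c \<otimes> (x [^] n \<otimes> (m \<otimes> (x \<otimes> y [^] n)) \<otimes> y) = c \<otimes> ((x [^] n \<otimes> m) \<otimes> (x \<otimes> y [^] n \<otimes> y))"
    using mem by (simp add: m_assoc)
  also have "x [^] n \<otimes> m = commutator (x [^] n) m \<otimes> (m \<otimes> x [^] n)"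
    using mem by (intro swap_commutator) auto
  also have "c \<otimes> (commutator (x [^] n) m \<otimes> (m \<otimes> x [^] n) \<otimes> (x \<otimes> y [^] n \<otimes> y)) =
      c \<otimes> (commutator (x [^] n) m \<otimes> m) \<otimes> (x [^] Suc n \<otimes> y [^] Suc n)"
    using mem by (simp add: m_assoc)
  finally show ?case using c' by blast
qed

text \<open>This absorbs the finite factors of a polycyclic series.
  An additive map \<open>p\<close> on \<open>H\<close> is invariant under \<open>K\<close> and vanishes on the commutators of \<open>K\<close>,
  so \<open>\<lambda>x. p (x [^] r)\<close> is additive on \<open>K\<close>. Its kernel contains the kernel of \<open>p\<close> with the same
  kind of quotient, which makes an induction along the series of \<open>H\<close> work.\<close>

lemma poly_infinite_cyclic_torsion_extension:
  assumes nil: "lower_central G c = {\<one>}"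
    and tf: "\<And>x n. \<lbrakk>x \<in> carrier G; n > 0; x [^] (n::nat) = \<one>\<rbrakk> \<Longrightarrow> x = \<one>"
    and r: "r > (0::nat)"
  assumes "poly_infinite_cyclic H" "subgroup K G" "H \<subseteq> K"
    "\<And>x y. x \<in> K \<Longrightarrow> y \<in> K \<Longrightarrow> commutator x y \<in> H"
    "\<And>x. x \<in> K \<Longrightarrow> x [^] r \<in> H"
  shows "poly_infinite_cyclic K"
  using assms(4-)
proof (induction H arbitrary: K rule: poly_infinite_cyclic.induct)
  case trivial
  have "x = \<one>" if "x \<in> K" for x
    using tf[OF _ r, of x] trivial.prems(4)[OF that] subgroup.mem_carrier[OF trivial.prems(1) that] by simp
  then have "K = {\<one>}" using subgroup.one_closed[OF trivial.prems(1)] by blast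
  then show ?case by (simp add: poly_infinite_cyclic.trivial)
next
  case (extension H p t)
  note H = extension.hyps(2) and p = extension.hyps(3) and K = extension.prems(1)
    and HK = extension.prems(2) and comm = extension.prems(3) and pow = extension.prems(4)
  have Kc: "x \<in> carrier G" if "x \<in> K" for x using that subgroup.mem_carrier[OF K] by auto
  have conjH: "x \<otimes> h \<otimes> inv x \<in> H" if "x \<in> K" "h \<in> H" for x h
    using that comm[of x h] HK Kc subgroup.m_closed[OF H]
    by (auto simp: conj_eq_commutator_mult subset_iff)
  have inv: "p (x \<otimes> h \<otimes> inv x) = p h" if "x \<in> K" "h \<in> H" for x h
    using additive_on_conj_invariant[OF nil H p Kc conjH r pow] that by blast
  \<comment> \<open>The value at \<open>[x, y [^] r]\<close> is \<open>r\<close> times the one at \<open>[x, y]\<close>. It is \<open>0\<close> by invariance, since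
    \<open>y [^] r\<close> lies in \<open>H\<close>.\<close>
  have p_comm: "p (commutator x y) = 0" if x: "x \<in> K" and y: "y \<in> K" for x y
  proof -
    have yj: "y [^] (j::nat) \<in> K" for j
      using subgroup_int_pow_closed[OF K y, of "int j"] by (simp add: int_pow_int)
    have "p (commutator x (y [^] j)) = int j * p (commutator x y)" for j :: nat
    proof (induction j)
      case 0
      then show ?case using Kc x additive_on_one[OF H p] by (simp add: commutator_def)
    next
      case (Suc j)
      have cH: "commutator x y \<in> H" "commutator x (y [^] j) \<in> H" using comm x y yj by auto
      have "p (commutator x (y [^] Suc j)) =
          p (commutator x (y [^] j)) + p (y [^] j \<otimes> commutator x y \<otimes> inv (y [^] j))"
        using additive_onD[OF p cH(2) conjH[OF yj cH(1)]] x y Kc by (simp add: commutator_mult_right)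
      then show ?case using Suc inv[OF yj cH(1)] by (simp add: algebra_simps)
    qed
    from this[of r] have "int r * p (commutator x y) = p (x \<otimes> y [^] r \<otimes> inv x \<otimes> inv (y [^] r))"
      by (simp add: commutator_def)
    also have "\<dots> = 0"
      using additive_onD[OF p conjH[OF x pow[OF y]] subgroup.m_inv_closed[OF H pow[OF y]]]
        inv[OF x pow[OF y]] additive_on_inv[OF H p pow[OF y]] by simp
    finally show ?thesis using r by simp
  qed
  let ?N = "{x \<in> H. p x = 0}" and ?q = "\<lambda>x. p (x [^] r)"
  have N: "subgroup ?N G" by (rule subgroup_additive_kernel[OF H p])
  have commN: "commutator x y \<in> ?N" if "x \<in> K" "y \<in> K" for x y
    using that comm p_comm by simp
  have q: "additive_on K ?q"
    unfolding additive_on_def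
  proof (intro ballI)
    fix x y assume xy: "x \<in> K" "y \<in> K"
    obtain d where d: "d \<in> ?N" "(x \<otimes> y) [^] r = d \<otimes> (x [^] r \<otimes> y [^] r)"
      using nat_pow_mult_mod[OF N K _ commN xy] HK by blast
    have "x [^] r \<otimes> y [^] r \<in> H" using pow xy subgroup.m_closed[OF H] by blast
    then show "?q (x \<otimes> y) = ?q x + ?q y"
      using d pow xy by (simp add: additive_onD[OF p])
  qed
  have "poly_infinite_cyclic {x \<in> K. ?q x = 0}"
  proof (rule extension.IH)
    show "subgroup {x \<in> K. ?q x = 0} G" by (rule subgroup_additive_kernel[OF K q])
    show "?N \<subseteq> {x \<in> K. ?q x = 0}" using HK additive_on_nat_pow[OF H p] by auto
  qed (use commN pow in auto)
  then show ?case by (rule poly_infinite_cyclic_of_additive[OF K q])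
qed

theorem poly_infinite_cyclic_of_polycyclic:
  assumes nil: "lower_central G c = {\<one>}"
    and tf: "\<And>x n. \<lbrakk>x \<in> carrier G; n > 0; x [^] (n::nat) = \<one>\<rbrakk> \<Longrightarrow> x = \<one>"
    and "polycyclic K"
  shows "poly_infinite_cyclic K"
  using assms(3)
proof (induction rule: polycyclic.induct)
  case trivial
  show ?case by (rule poly_infinite_cyclic.trivial)
next
  case (cyclic_extension H K a)
  note H = cyclic_extension.hyps(2) and K = cyclic_extension.hyps(3)
    and HK = cyclic_extension.hyps(4) and comm = cyclic_extension.hyps(5)
    and a = cyclic_extension.hyps(6) and gen = cyclic_extension.hyps(7)
  have Kc: "x \<in> carrier G" if "x \<in> K" for x using that subgroup.mem_carrier[OF K] by auto
  show ?case
  proof (cases "\<exists>r::nat>0. a [^] r \<in> H")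
    case True
    then obtain r :: nat where r: "r > 0" "a [^] r \<in> H" by blast
    have pow: "x [^] r \<in> H" if x: "x \<in> K" for x
    proof -
      obtain k where k: "a [^] (k::int) \<otimes> x \<in> H" using gen[OF x] by blast
      define h where "h = a [^] k \<otimes> x"
      have ak: "a [^] (-k) \<in> K" by (rule subgroup_int_pow_closed[OF K a])
      have x_eq: "x = a [^] (-k) \<otimes> h"
        using Kc[OF a] Kc[OF x] by (simp add: h_def int_pow_neg)
      have "(a [^] (-k)) [^] r = (a [^] r) [^] (-k)"
        using int_pow_pow[OF Kc[OF a], of "-k" "int r"] int_pow_pow[OF Kc[OF a], of "int r" "-k"]
        by (simp add: int_pow_int mult.commute)
      then have "(a [^] (-k)) [^] r \<in> H"
        using subgroup_int_pow_closed[OF H r(2), of "-k"] by simp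
      moreover have "h [^] r \<in> H"
        using subgroup_int_pow_closed[OF H k, of "int r"] by (simp add: int_pow_int h_def)
      moreover obtain d where "d \<in> H" "x [^] r = d \<otimes> ((a [^] (-k)) [^] r \<otimes> h [^] r)"
        using nat_pow_mult_mod[OF H K HK comm ak, of h r] k HK x_eq unfolding h_def by auto
      ultimately show ?thesis using subgroup.m_closed[OF H] by metis
    qed
    show ?thesis
      by (rule poly_infinite_cyclic_torsion_extension[OF nil _ r(1) cyclic_extension.IH K HK])
        (use tf comm pow in auto)
  next
    case False
    have uniq: "k = l" if "a [^] (k::int) \<otimes> x \<in> H" "a [^] (l::int) \<otimes> x \<in> H" "x \<in> K" for k l x
    proof (rule ccontr)
      assume "k \<noteq> l"
      have "a [^] (k - l) = (a [^] k \<otimes> x) \<otimes> inv (a [^] l \<otimes> x)"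
        using that(3) Kc a by (simp add: word_simps int_pow_diff)
      then have kl: "a [^] (k - l) \<in> H"
        using that subgroup.m_closed[OF H] subgroup.m_inv_closed[OF H] by simp
      then have "a [^] (l - k) \<in> H"
        using subgroup.m_inv_closed[OF H kl] Kc[OF a] by (simp flip: int_pow_neg)
      with kl have "a [^] \<bar>k - l\<bar> \<in> H" by (simp add: abs_if)
      moreover have "a [^] \<bar>k - l\<bar> = a [^] nat \<bar>k - l\<bar>"
        using int_pow_int[of G a "nat \<bar>k - l\<bar>"] by simp
      moreover have "nat \<bar>k - l\<bar> > 0" using \<open>k \<noteq> l\<close> by simp
      ultimately show False using False by metis
    qed
    define p where "p x = (SOME k::int. a [^] k \<otimes> x \<in> H)" for x
    have p: "a [^] p x \<otimes> x \<in> H" if "x \<in> K" for x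
      unfolding p_def using gen[OF that] by (rule someI_ex)
    have "additive_on K p"
      unfolding additive_on_def
    proof (intro ballI)
      fix x y assume xy: "x \<in> K" "y \<in> K"
      have "a [^] (p y + p x) \<otimes> (x \<otimes> y) \<in> H"
        by (rule int_pow_mult_mod[OF H K comm HK a xy]) (use p xy in auto)
      then show "p (x \<otimes> y) = p x + p y"
        using uniq p subgroup.m_closed[OF K] xy by (metis add.commute)
    qed
    moreover have "{x \<in> K. p x = 0} = H"
    proof (intro equalityI subsetI)
      fix x assume "x \<in> {x \<in> K. p x = 0}"
      then show "x \<in> H" using p[of x] Kc by simp
    next
      fix x assume x: "x \<in> H"
      then have "a [^] (0::int) \<otimes> x \<in> H" using subgroup.mem_carrier[OF H] by simp
      then show "x \<in> {x \<in> K. p x = 0}" using uniq[OF p] x HK by blast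
    qed
    ultimately show ?thesis
      using poly_infinite_cyclic_of_additive[OF K] cyclic_extension.IH by simp
  qed
qed

section \<open>Polynomial maps to the integers\<close>

abbreviation left_diff :: "'a \<Rightarrow> ('a \<Rightarrow> int) \<Rightarrow> 'a \<Rightarrow> int"
  where "left_diff h f \<equiv> \<lambda>x. f (h \<otimes> x) - f x"

text \<open>Polynomial maps of degree less than \<open>d\<close>. For \<open>d = 0\<close> only the zero map remains, for \<open>d = 1\<close>
  the constants, and for \<open>d = 2\<close> the sums of constants and homomorphisms to the integers.\<close>

primrec deg_less :: "'a set \<Rightarrow> nat \<Rightarrow> ('a \<Rightarrow> int) \<Rightarrow> bool"
  where
    "deg_less H 0 f \<longleftrightarrow> (\<forall>x\<in>H. f x = 0)"
  | "deg_less H (Suc d) f \<longleftrightarrow> (\<forall>h\<in>H. deg_less H d (left_diff h f))"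

lemma deg_less_cong:
  assumes "subgroup H G" and "\<And>x. x \<in> H \<Longrightarrow> f x = g x"
  shows "deg_less H d f \<longleftrightarrow> deg_less H d g"
  using assms(2)
proof (induction d arbitrary: f g)
  case (Suc d)
  have "deg_less H d (left_diff h f) \<longleftrightarrow> deg_less H d (left_diff h g)" if "h \<in> H" for h
    using that Suc.prems subgroup.m_closed[OF assms(1)] by (intro Suc.IH) auto
  then show ?case by simp
qed simp

lemma deg_less_lincomb:
  assumes "deg_less H d f" "deg_less H d g"
  shows "deg_less H d (\<lambda>x. a * f x + b * g x)"
  using assms
proof (induction d arbitrary: f g)
  case (Suc d)
  show ?case
    unfolding deg_less.simps
  proof
    fix h assume "h \<in> H"
    then have "deg_less H d (\<lambda>x. a * left_diff h f x + b * left_diff h g x)"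
      using Suc by simp
    then show "deg_less H d (left_diff h (\<lambda>x. a * f x + b * g x))"
      by (simp add: algebra_simps)
  qed
qed simp

lemma deg_less_Suc:
  assumes H: "subgroup H G" and "deg_less H d f"
  shows "deg_less H (Suc d) f"
  using assms(2)
proof (induction d arbitrary: f)
  case 0
  then show ?case using subgroup.m_closed[OF H] by simp
next
  case (Suc d)
  show ?case
    unfolding deg_less.simps(2)[of H "Suc d"]
    using Suc.IH Suc.prems unfolding deg_less.simps(2)[of H d f] by blast
qed

lemma deg_less_mono:
  assumes H: "subgroup H G" and "deg_less H d f" and "d \<le> e"
  shows "deg_less H e f"
  using assms(3,2) by (induction rule: dec_induct) (assumption, blast intro: deg_less_Suc[OF H])

text \<open>Here a difference by an element of \<open>lower_central G i\<close> must lower the degree by \<open>i + 1\<close>. The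
  purpose of the weights is that conjugations by elements of \<open>G\<close>, and not only translations, act
  unipotently; the filtration is that of the ambient group \<open>G\<close>, as the conjugating elements need
  not lie in \<open>N\<close>.\<close>

fun weight_less :: "'a set \<Rightarrow> nat \<Rightarrow> ('a \<Rightarrow> int) \<Rightarrow> bool"
  where
    "weight_less N 0 f \<longleftrightarrow> (\<forall>x\<in>N. f x = 0)"
  | "weight_less N (Suc d) f \<longleftrightarrow>
      (\<forall>i. \<forall>h\<in>N \<inter> lower_central G i. weight_less N (d - i) (left_diff h f))"

lemma weight_less_cong:
  assumes "subgroup N G" and "\<And>x. x \<in> N \<Longrightarrow> f x = g x"
  shows "weight_less N d f \<longleftrightarrow> weight_less N d g"
  using assms(2)
proof (induction d arbitrary: f g rule: less_induct)
  case (less d)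
  show ?case
  proof (cases d)
    case 0
    then show ?thesis using less.prems by simp
  next
    case (Suc e)
    have "weight_less N (e - i) (left_diff h f) \<longleftrightarrow> weight_less N (e - i) (left_diff h g)"
      if "h \<in> N" for h i
      using that less.prems subgroup.m_closed[OF assms(1)] Suc by (intro less.IH) auto
    then show ?thesis using Suc by simp
  qed
qed

lemma weight_less_add:
  assumes "weight_less N d f" "weight_less N d g"
  shows "weight_less N d (\<lambda>x. f x + g x)"
  using assms
proof (induction d arbitrary: f g rule: less_induct)
  case (less d)
  show ?case
  proof (cases d)
    case 0
    then show ?thesis using less.prems by simp
  next
    case (Suc e)
    have "weight_less N (e - i) (\<lambda>x. left_diff h f x + left_diff h g x)"
      if "h \<in> N \<inter> lower_central G i" for h i
      using that less.prems Suc by (intro less.IH) auto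
    then show ?thesis using Suc by (simp add: algebra_simps)
  qed
qed

lemma weight_less_Suc:
  assumes N: "subgroup N G" and "weight_less N d f"
  shows "weight_less N (Suc d) f"
  using assms(2)
proof (induction d arbitrary: f rule: less_induct)
  case (less d)
  show ?case
  proof (cases d)
    case 0
    then show ?thesis using less.prems subgroup.m_closed[OF N] by simp
  next
    case (Suc e)
    have "weight_less N (d - i) (left_diff h f)" if "h \<in> N \<inter> lower_central G i" for h i
    proof -
      have *: "weight_less N (e - i) (left_diff h f)" using less.prems Suc that by simp
      show ?thesis
      proof (cases "i \<le> e")
        case True
        then show ?thesis using less.IH[of "e - i", OF _ *] Suc by (simp add: Suc_diff_le)
      qed (use * Suc in simp)
    qed
    then show ?thesis by simp
  qed
qed

lemma weight_less_mono:
  assumes N: "subgroup N G" and "weight_less N d f" and "d \<le> e"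
  shows "weight_less N e f"
  using assms(3,2) by (induction rule: dec_induct) (assumption, blast intro: weight_less_Suc[OF N])

lemma weight_less_left_diff:
  assumes "weight_less N d f" "h \<in> N" "h \<in> lower_central G i" and N: "subgroup N G"
  shows "weight_less N (d - Suc i) (left_diff h f)"
proof (cases d)
  case 0
  then show ?thesis using assms(1,2) subgroup.m_closed[OF N] by simp
qed (use assms in simp)

lemma weight_less_translate:
  assumes f: "weight_less N d f" and h: "h \<in> N" and N: "subgroup N G"
  shows "weight_less N d (\<lambda>x. f (h \<otimes> x))"
proof -
  have "weight_less N (d - Suc 0) (left_diff h f)"
    using weight_less_left_diff[OF f h _ N, of 0] h subgroup.mem_carrier[OF N] by simp
  then have "weight_less N d (left_diff h f)"
    by (rule weight_less_mono[OF N]) simp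
  from weight_less_add[OF f this] show ?thesis by simp
qed

text \<open>A nontrivial element lies in no term of the lower central series of index \<open>c\<close> or more, so
  that a difference by it need not lower the weight by more than \<open>c\<close>. The factor is \<open>c + 1\<close> rather
  than \<open>c\<close> so that nonzero constants have positive weight in the trivial group, where \<open>c\<close> may be \<open>0\<close>.\<close>

lemma weight_less_of_deg_less:
  assumes nil: "lower_central G c = {\<one>}" and N: "subgroup N G" and "deg_less N d f"
  shows "weight_less N (Suc c * d) f"
  using assms(3)
proof (induction d arbitrary: f)
  case (Suc d)
  have "weight_less N (c + Suc c * d - i) (left_diff h f)" if h: "h \<in> N" "h \<in> lower_central G i" for h i
  proof (cases "i \<le> c")
    case True
    have "weight_less N (Suc c * d) (left_diff h f)" using Suc h by simp
    then show ?thesis by (rule weight_less_mono[OF N]) (use True in simp)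
  next
    case False
    then have "h = \<one>" using h lower_central_antimono[of c i] nil by auto
    then have "weight_less N 0 (left_diff h f)" using subgroup.mem_carrier[OF N] by simp
    then show ?thesis by (rule weight_less_mono[OF N]) simp
  qed
  then show ?case by simp
qed simp

text \<open>Conjugation by \<open>t\<close> changes \<open>h\<close> by the factor \<open>[t, h]\<close>, which lies one step deeper in the lower
  central series than \<open>h\<close>. This is why the change of \<open>f\<close> has smaller weight.\<close>

lemma weight_less_conj:
  assumes N: "subgroup N G" and t: "t \<in> carrier G" and tN: "\<And>x. x \<in> N \<Longrightarrow> t \<otimes> x \<otimes> inv t \<in> N"
    and "weight_less N d f"
  shows "weight_less N d (\<lambda>x. f (t \<otimes> x \<otimes> inv t)) \<and>
    weight_less N (d - 1) (\<lambda>x. f (t \<otimes> x \<otimes> inv t) - f x)"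
  using assms(4)
proof (induction d arbitrary: f rule: less_induct)
  case (less d)
  have Nc: "x \<in> carrier G" if "x \<in> N" for x using that subgroup.mem_carrier[OF N] by auto
  have diff: "weight_less N (d - 1) (\<lambda>x. f (t \<otimes> x \<otimes> inv t) - f x)"
  proof (cases "d \<le> 1")
    case True
    have const: "f x = f y" if "x \<in> N" "y \<in> N" for x y
    proof (cases d)
      case 0
      then show ?thesis using less.prems that by simp
    next
      case (Suc e)
      then have "weight_less N 0 (left_diff (x \<otimes> inv y) f)"
        using True weight_less_left_diff[OF less.prems, of "x \<otimes> inv y" 0] that Nc N
        by (simp add: subgroup.m_closed subgroup.m_inv_closed)
      then show ?thesis using that Nc by (auto simp: m_assoc)
    qed
    have "weight_less N 0 (\<lambda>x. f (t \<otimes> x \<otimes> inv t) - f x)"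
      using const[OF tN] by (simp only: weight_less.simps(1)) auto
    then show ?thesis by (rule weight_less_mono[OF N]) simp
  next
    case False
    then obtain e where e: "d = Suc (Suc e)"
      using that[of "d - 2"] by simp
    have "weight_less N (e - i) (left_diff h (\<lambda>x. f (t \<otimes> x \<otimes> inv t) - f x))"
      if h: "h \<in> N" "h \<in> lower_central G i" for h i
    proof -
      \<comment> \<open>Conjugating \<open>h \<otimes> x\<close> produces an extra factor \<open>u\<close> on the left. The difference by \<open>h\<close> of the
        change of \<open>f\<close> is therefore a difference of \<open>f\<close> by \<open>u\<close> plus the change of a difference by \<open>h\<close>.\<close>
      define u where "u = commutator t h"
      have u: "u \<in> N" "u \<in> lower_central G (Suc i)"
        unfolding u_def
        using subgroup.m_closed[OF N tN[OF h(1)] subgroup.m_inv_closed[OF N h(1)]]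
          commutator_lower_central(2)[OF h(2) t]
        by (simp_all add: commutator_def)
      define v where "v x = left_diff u f (h \<otimes> x)" for x
      have "weight_less N (e - i) (left_diff u f)"
        using weight_less_left_diff[OF less.prems u N] by (simp add: e)
      then have "weight_less N (e - i) v"
        unfolding v_def by (rule weight_less_translate[OF _ h(1) N])
      then have 1: "weight_less N (e - i) (\<lambda>x. v (t \<otimes> x \<otimes> inv t))"
        using less.IH[of "e - i" v] by (simp add: e)
      have "weight_less N (Suc e - i) (left_diff h f)"
        using weight_less_left_diff[OF less.prems h N] by (simp add: e)
      then have "weight_less N (Suc e - i - 1)
          (\<lambda>x. left_diff h f (t \<otimes> x \<otimes> inv t) - left_diff h f x)"
        using less.IH[of "Suc e - i" "left_diff h f"] by (simp add: e)
      then have 2: "weight_less N (e - i) (\<lambda>x. left_diff h f (t \<otimes> x \<otimes> inv t) - left_diff h f x)"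
        by simp
      have "t \<otimes> (h \<otimes> x) \<otimes> inv t = u \<otimes> (h \<otimes> (t \<otimes> x \<otimes> inv t))" if "x \<in> N" for x
        using Nc that h(1) t by (simp add: u_def commutator_def word_simps)
      then have eq: "left_diff h (\<lambda>x. f (t \<otimes> x \<otimes> inv t) - f x) x =
          v (t \<otimes> x \<otimes> inv t) + (left_diff h f (t \<otimes> x \<otimes> inv t) - left_diff h f x)" if "x \<in> N" for x
        using that by (simp add: v_def)
      show ?thesis
        by (rule weight_less_cong[OF N eq, THEN iffD2]) (use weight_less_add[OF 1 2] in auto)
    qed
    then show ?thesis by (simp add: e)
  qed
  have "weight_less N d (\<lambda>x. f (t \<otimes> x \<otimes> inv t) - f x)"
    using diff by (rule weight_less_mono[OF N]) simp
  from weight_less_add[OF less.prems this] show ?case using diff by simp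
qed

text \<open>The map \<open>\<lambda>x. x \<otimes> t [^] (- p x)\<close> is the projection to \<open>N\<close> of the semidirect product \<open>K\<close> of
  \<open>N\<close> and the powers of \<open>t\<close>. It intertwines left multiplication by \<open>g\<close> with the composition of a
  conjugation and a translation of \<open>N\<close>, both of which act unipotently on weighted polynomials.\<close>

lemma deg_less_extend:
  assumes K: "subgroup K G" and p: "additive_on K p" and t: "t \<in> K" "p t = 1"
    and N: "N = {x \<in> K. p x = 0}" and "weight_less N d f"
  shows "deg_less K d (\<lambda>x. f (x \<otimes> t [^] (- p x)))"
  using assms(6)
proof (induction d arbitrary: f)
  case 0
  have "x \<otimes> t [^] (- p x) \<in> N" if "x \<in> K" for x
    using that t subgroup.m_closed[OF K] subgroup_int_pow_closed[OF K t(1)]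
      additive_onD[OF p] additive_on_int_pow[OF K p t(1)] by (simp add: N)
  then show ?case using 0 by simp
next
  case (Suc d)
  have N_sub: "subgroup N G" unfolding N by (rule subgroup_additive_kernel[OF K p])
  have Kc: "x \<in> carrier G" if "x \<in> K" for x using that subgroup.mem_carrier[OF K] by auto
  have tk: "t [^] k \<in> K" for k :: int by (rule subgroup_int_pow_closed[OF K t(1)])
  define \<nu> where "\<nu> x = x \<otimes> t [^] (- p x)" for x
  have \<nu>: "\<nu> x \<in> N" if "x \<in> K" for x
    using that t subgroup.m_closed[OF K] tk additive_onD[OF p] additive_on_int_pow[OF K p t(1)]
    by (simp add: N \<nu>_def)
  show ?case
    unfolding deg_less.simps
  proof
    fix g assume g: "g \<in> K"
    define s where "s = t [^] p g"
    have s: "s \<in> K" unfolding s_def by (rule tk)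
    have sN: "s \<otimes> x \<otimes> inv s \<in> N" if "x \<in> N" for x
      using that s additive_on_conj[OF K p s] subgroup.m_closed[OF K] subgroup.m_inv_closed[OF K]
      by (simp add: N)
    have "weight_less N d (left_diff (\<nu> g) f)"
      using weight_less_left_diff[OF Suc.prems \<nu>[OF g] _ N_sub, of 0] Kc \<nu>[OF g] N by simp
    then have 1: "weight_less N d (\<lambda>x. left_diff (\<nu> g) f (s \<otimes> x \<otimes> inv s))"
      using weight_less_conj[OF N_sub Kc[OF s] sN] by blast
    have 2: "weight_less N d (\<lambda>x. f (s \<otimes> x \<otimes> inv s) - f x)"
      using weight_less_conj[OF N_sub Kc[OF s] sN Suc.prems] by simp
    define f' where "f' x = f (\<nu> g \<otimes> (s \<otimes> x \<otimes> inv s)) - f x" for x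
    have "weight_less N d f'"
      using weight_less_add[OF 1 2] unfolding f'_def by simp
    then have f': "deg_less K d (\<lambda>x. f' (\<nu> x))"
      unfolding \<nu>_def by (rule Suc.IH)
    have \<nu>_mult: "\<nu> (g \<otimes> x) = \<nu> g \<otimes> (s \<otimes> \<nu> x \<otimes> inv s)" if "x \<in> K" for x
    proof -
      have "- p (g \<otimes> x) = - p x - p g"
        using additive_onD[OF p g that] by simp
      then have "t [^] (- p (g \<otimes> x)) = t [^] (- p x) \<otimes> inv (t [^] p g)"
        using int_pow_diff[OF Kc[OF t(1)], of "- p x" "p g"] by (simp only:)
      then have "\<nu> (g \<otimes> x) = g \<otimes> x \<otimes> (t [^] (- p x) \<otimes> inv s)"
        by (simp only: \<nu>_def s_def)
      then show ?thesis
        using Kc g that t(1) by (simp add: \<nu>_def s_def word_simps int_pow_neg)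
    qed
    have "left_diff g (\<lambda>x. f (\<nu> x)) x = f' (\<nu> x)" if "x \<in> K" for x
      using \<nu>_mult[OF that] by (simp add: f'_def)
    from deg_less_cong[OF K this, THEN iffD2, OF _ f']
    show "deg_less K d (left_diff g (\<lambda>x. f (x \<otimes> t [^] (- p x))))"
      unfolding \<nu>_def by simp
  qed
qed

text \<open>Along \<open>K\<close>, an element outside the kernel \<open>N\<close> of \<open>p\<close> is detected by \<open>p\<close> itself, and one in
  \<open>N\<close> by the extension of a polynomial on \<open>N\<close>. The degree is bounded because the series is finite.\<close>

lemma polynomials_separate_points:
  assumes nil: "lower_central G c = {\<one>}" and "poly_infinite_cyclic K"
  shows "\<exists>d. \<forall>g\<in>K. g \<noteq> \<one> \<longrightarrow> (\<exists>f. deg_less K d f \<and> f g \<noteq> f \<one>)"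
  using assms(2)
proof (induction rule: poly_infinite_cyclic.induct)
  case trivial
  then show ?case by simp
next
  case (extension K p t)
  note K = extension.hyps(2) and p = extension.hyps(3) and t = extension.hyps(4,5)
  define N where "N = {x \<in> K. p x = 0}"
  have N: "subgroup N G" unfolding N_def by (rule subgroup_additive_kernel[OF K p])
  obtain d where d: "\<And>g. g \<in> N \<Longrightarrow> g \<noteq> \<one> \<Longrightarrow> \<exists>f. deg_less N d f \<and> f g \<noteq> f \<one>"
    using extension.IH unfolding N_def by blast
  have one: "\<one> \<in> K" "p \<one> = 0" using subgroup.one_closed[OF K] additive_on_one[OF K p] by auto
  let ?e = "max 2 (Suc c * d)"
  have "\<exists>f. deg_less K ?e f \<and> f g \<noteq> f \<one>" if g: "g \<in> K" "g \<noteq> \<one>" for g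
  proof (cases "p g = 0")
    case True
    then obtain f where f: "deg_less N d f" "f g \<noteq> f \<one>" using d g unfolding N_def by blast
    let ?f = "\<lambda>x. f (x \<otimes> t [^] (- p x))"
    have "deg_less K (Suc c * d) ?f"
      by (rule deg_less_extend[OF K p t N_def weight_less_of_deg_less[OF nil N f(1)]])
    then have "deg_less K ?e ?f" by (rule deg_less_mono[OF K]) simp
    moreover have "?f g \<noteq> ?f \<one>"
      using f(2) True one subgroup.mem_carrier[OF K g(1)] by simp
    ultimately show ?thesis by blast
  next
    case False
    have "deg_less K 2 p"
      using additive_onD[OF p] subgroup.m_closed[OF K] by (simp add: numeral_2_eq_2)
    then have "deg_less K ?e p" by (rule deg_less_mono[OF K]) simp
    then show ?thesis using False one by auto
  qed
  then show ?case by blast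
qed

end

section \<open>Bases adapted to the degree\<close>

text \<open>A basis over the integers of the functions satisfying \<open>P\<close>, where functions that agree on \<open>U\<close>
  count as equal. Indexing by numbers rather than by a set lets a basis be extended at its end.\<close>

definition function_basis :: "'a set \<Rightarrow> nat \<Rightarrow> (nat \<Rightarrow> 'a \<Rightarrow> int) \<Rightarrow> (('a \<Rightarrow> int) \<Rightarrow> bool) \<Rightarrow> bool"
  where "function_basis U n b P \<longleftrightarrow>
    (\<forall>i<n. P (b i)) \<and>
    (\<forall>f. P f \<longrightarrow> (\<exists>c. \<forall>x\<in>U. f x = (\<Sum>i<n. c i * b i x))) \<and>
    (\<forall>c. (\<forall>x\<in>U. (\<Sum>i<n. c i * b i x) = 0) \<longrightarrow> (\<forall>i<n. c i = 0))"

lemma function_basisD: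
  assumes "function_basis U n b P"
  shows function_basis_member: "i < n \<Longrightarrow> P (b i)"
    and function_basis_span: "P f \<Longrightarrow> \<exists>c. \<forall>x\<in>U. f x = (\<Sum>i<n. c i * b i x)"
    and function_basis_independent: "(\<And>x. x \<in> U \<Longrightarrow> (\<Sum>i<n. c i * b i x) = 0) \<Longrightarrow> i < n \<Longrightarrow> c i = 0"
  using assms unfolding function_basis_def by simp_all

lemma function_basis_cong:
  assumes "\<And>i. i < n \<Longrightarrow> b i = b' i"
  shows "function_basis U n b P \<longleftrightarrow> function_basis U n b' P"
proof -
  have "(\<Sum>i<n. c i * b i x) = (\<Sum>i<n. c i * b' i x)" for c x
    using assms by (intro sum.cong) auto
  then show ?thesis
    using assms unfolding function_basis_def by simp
qed

lemma function_basis_unique: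
  assumes "function_basis U n b P"
    and "\<And>x. x \<in> U \<Longrightarrow> (\<Sum>i<n. u i * b i x) = (\<Sum>i<n. v i * b i x)" and "i < n"
  shows "u i = v i"
proof -
  have "(\<Sum>i<n. (u i - v i) * b i x) = 0" if "x \<in> U" for x
    using assms(2)[OF that] by (simp add: algebra_simps sum_subtractf)
  then have "u i - v i = 0"
    by (rule function_basis_independent[OF assms(1) _ assms(3)])
  then show ?thesis by simp
qed

definition functional_on :: "'a set \<Rightarrow> (('a \<Rightarrow> int) \<Rightarrow> int) \<Rightarrow> bool"
  where "functional_on U l \<longleftrightarrow>
    (\<forall>f g a b. l (\<lambda>x. a * f x + b * g x) = a * l f + b * l g) \<and>
    (\<forall>f g. (\<forall>x\<in>U. f x = g x) \<longrightarrow> l f = l g)"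

lemma functional_onD:
  assumes "functional_on U l"
  shows functional_on_lincomb: "l (\<lambda>x. a * f x + b * g x) = a * l f + b * l g"
    and functional_on_cong: "(\<And>x. x \<in> U \<Longrightarrow> f x = g x) \<Longrightarrow> l f = l g"
  using assms unfolding functional_on_def by simp_all

lemma functional_on_sum:
  fixes n :: nat
  assumes "functional_on U l"
  shows "l (\<lambda>x. \<Sum>i<n. c i * b i x) = (\<Sum>i<n. c i * l (b i))"
proof (induction n)
  case 0
  have "l (\<lambda>x. 0 * (0::int) + 0 * 0) = 0 * l (\<lambda>x. 0) + 0 * l (\<lambda>x. 0)"
    by (rule functional_on_lincomb[OF assms])
  then show ?case by simp
next
  case (Suc n)
  have "l (\<lambda>x. 1 * (\<Sum>i<n. c i * b i x) + c n * b n x) = 1 * l (\<lambda>x. \<Sum>i<n. c i * b i x) + c n * l (b n)"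
    by (rule functional_on_lincomb[OF assms])
  then show ?case using Suc by simp
qed

text \<open>The values of a functional form a cyclic group of integers. A function on which the value is a
  generator extends a basis of the kernel.\<close>

lemma function_basis_extend_one:
  assumes P: "\<And>f g a b. P f \<Longrightarrow> P g \<Longrightarrow> P (\<lambda>x. a * f x + b * g x)"
    and l: "functional_on U l"
    and basis: "function_basis U n b (\<lambda>f. P f \<and> l f = 0)"
  shows "\<exists>n'\<ge>n. \<exists>b'. (\<forall>i<n. b' i = b i) \<and> function_basis U n' b' P"
proof (cases "\<exists>f. P f \<and> l f \<noteq> 0")
  case False
  then have "(\<lambda>f. P f \<and> l f = 0) = P" by auto
  then show ?thesis using basis by auto
next
  case True
  have lin: "l (\<lambda>x. a * f x + b * g x) = a * l f + b * l g" for f g a b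
    by (rule functional_on_lincomb[OF l])
  let ?Q = "\<lambda>k. k > 0 \<and> (\<exists>f. P f \<and> l f = int k)"
  obtain f where f: "P f" "l f \<noteq> 0" using True by blast
  have "?Q (nat \<bar>l f\<bar>)"
  proof -
    have "P (\<lambda>x. sgn (l f) * f x + 0 * f x)" using P f(1) by blast
    moreover have "l (\<lambda>x. sgn (l f) * f x + 0 * f x) = \<bar>l f\<bar>"
      unfolding lin by (simp add: abs_sgn mult.commute)
    ultimately show ?thesis using f(2) by (intro conjI exI[of _ "\<lambda>x. sgn (l f) * f x + 0 * f x"]) auto
  qed
  then have e: "?Q (LEAST k. ?Q k)" by (rule LeastI)
  define e where "e = (LEAST k. ?Q k)"
  obtain h where h: "P h" "l h = int e" and "e > 0" using e unfolding e_def by blast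
  define b' where "b' = b(n := h)"
  have b': "(\<Sum>i<Suc n. c i * b' i x) = (\<Sum>i<n. c i * b i x) + c n * h x" for c x
    by (simp add: b'_def)
  have span: "\<exists>c. \<forall>x\<in>U. g x = (\<Sum>i<Suc n. c i * b' i x)" if g: "P g" for g
  proof -
    define q where "q = l g div int e"
    define g' where "g' x = 1 * g x + (- q) * h x" for x
    have g': "P g'" unfolding g'_def using g h(1) by (rule P)
    have "l g' = l g mod int e"
      unfolding g'_def lin h(2) q_def by (simp add: minus_div_mult_eq_mod)
    moreover have "\<not> ?Q (nat (l g mod int e))"
      using not_less_Least[of "nat (l g mod int e)" ?Q] \<open>e > 0\<close>
      unfolding e_def[symmetric] by (simp add: nat_less_iff)
    ultimately have "l g' = 0"
      using \<open>e > 0\<close> g' pos_mod_sign[of "int e" "l g"] by (cases "l g mod int e = 0") force+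
    with g' obtain c where c: "\<And>x. x \<in> U \<Longrightarrow> g' x = (\<Sum>i<n. c i * b i x)"
      using function_basis_span[OF basis, of g'] by blast
    have "g x = (\<Sum>i<Suc n. (c(n := q)) i * b' i x)" if "x \<in> U" for x
      using c[OF that] unfolding b' by (simp add: g'_def)
    then show ?thesis by blast
  qed
  have indep: "\<forall>i<Suc n. c i = 0" if c: "\<forall>x\<in>U. (\<Sum>i<Suc n. c i * b' i x) = 0" for c
  proof -
    define s where "s x = (\<Sum>i<n. c i * b i x)" for x
    have "l s = 0"
      unfolding s_def functional_on_sum[OF l]
      using function_basis_member[OF basis] by simp
    have z: "1 * s x + c n * h x = 0 * s x + 0 * s x" if "x \<in> U" for x
      using c that unfolding b' s_def by simp
    have "l (\<lambda>x. 1 * s x + c n * h x) = l (\<lambda>x. 0 * s x + 0 * s x)"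
      by (rule functional_on_cong[OF l z])
    then have "c n = 0"
      unfolding lin using \<open>l s = 0\<close> h(2) \<open>e > 0\<close> by simp
    then have "(\<Sum>i<n. c i * b i x) = 0" if "x \<in> U" for x using c that unfolding b' by simp
    then have "\<forall>i<n. c i = 0" using function_basis_independent[OF basis] by blast
    then show ?thesis using \<open>c n = 0\<close> by (auto simp: less_Suc_eq)
  qed
  have "\<forall>i<Suc n. P (b' i)"
    using function_basis_member[OF basis] h(1) unfolding b'_def by (auto simp: less_Suc_eq)
  then have "function_basis U (Suc n) b' P"
    unfolding function_basis_def by (intro conjI allI impI) (use span indep in simp_all)
  then show ?thesis by (intro exI[of _ "Suc n"] conjI exI[of _ b']) (auto simp: b'_def)
qed

lemma function_basis_extend:
  assumes "\<And>f g a b. P f \<Longrightarrow> P g \<Longrightarrow> P (\<lambda>x. a * f x + b * g x)"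
    and "\<forall>l\<in>set L. functional_on U l"
    and "function_basis U n b (\<lambda>f. P f \<and> (\<forall>l\<in>set L. l f = 0))"
  shows "\<exists>n'\<ge>n. \<exists>b'. (\<forall>i<n. b' i = b i) \<and> function_basis U n' b' P"
  using assms
proof (induction L arbitrary: P)
  case Nil
  then show ?case by auto
next
  case (Cons l L)
  let ?P = "\<lambda>f. P f \<and> l f = 0"
  have l: "functional_on U l" using Cons.prems(2) by simp
  have lin: "?P (\<lambda>x. a * f x + b * g x)" if "?P f" "?P g" for f g a b
    using that Cons.prems(1) by (simp add: functional_on_lincomb[OF l])
  have eq: "(\<lambda>f. P f \<and> (\<forall>l\<in>set (l # L). l f = 0)) = (\<lambda>f. ?P f \<and> (\<forall>l\<in>set L. l f = 0))"
    by auto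
  have "\<forall>l\<in>set L. functional_on U l" using Cons.prems(2) by simp
  from Cons.IH[of ?P, OF lin this Cons.prems(3)[unfolded eq]]
  obtain n' b' where n': "n \<le> n'" "\<forall>i<n. b' i = b i" "function_basis U n' b' ?P"
    by blast
  then obtain n'' b'' where "n' \<le> n''" "\<forall>i<n'. b'' i = b' i" "function_basis U n'' b'' P"
    using function_basis_extend_one[OF Cons.prems(1) l n'(3)] by blast
  then show ?case using n'(1,2) by (metis order_trans less_le_trans)
qed

context group
begin

text \<open>Value at \<open>\<one>\<close> of an iterated difference. Taken along the words of length \<open>d\<close> in the generators,
  these functionals cut out the polynomials of degree less than \<open>d\<close> among those of degree \<open>d\<close>.\<close>

primrec word_diff :: "'a list \<Rightarrow> ('a \<Rightarrow> int) \<Rightarrow> int"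
  where
    "word_diff [] f = f \<one>"
  | "word_diff (s # w) f = word_diff w (left_diff s f)"

lemma word_diff_functional:
  assumes "set w \<subseteq> carrier G" shows "functional_on (carrier G) (word_diff w)"
proof -
  have "word_diff w (\<lambda>x. a * f x + b * g x) = a * word_diff w f + b * word_diff w g" for f g a b
  proof (induction w arbitrary: f g)
    case (Cons s w)
    have "left_diff s (\<lambda>x. a * f x + b * g x) = (\<lambda>x. a * left_diff s f x + b * left_diff s g x)"
      by (simp add: algebra_simps)
    then show ?case using Cons by simp
  qed simp
  moreover have "word_diff w f = word_diff w g" if "\<forall>x\<in>carrier G. f x = g x" for f g
    using that assms
  proof (induction w arbitrary: f g)
    case (Cons s w)
    have "\<forall>x\<in>carrier G. left_diff s f x = left_diff s g x" using Cons.prems by simp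
    then show ?case using Cons by simp
  qed simp
  ultimately show ?thesis unfolding functional_on_def by blast
qed

abbreviation poly_less :: "nat \<Rightarrow> ('a \<Rightarrow> int) \<Rightarrow> bool"
  where "poly_less \<equiv> deg_less (carrier G)"

lemma poly_less_translate:
  assumes "poly_less d f" "h \<in> carrier G"
  shows "poly_less d (\<lambda>x. f (h \<otimes> x))"
proof -
  have "poly_less d (left_diff h f)"
    using deg_less_Suc[OF subgroup_self assms(1)] assms(2) by simp
  from deg_less_lincomb[OF assms(1) this, of 1 1] show ?thesis by simp
qed

text \<open>The elements whose difference lowers the degree form a subgroup, so that it is enough to test
  a generating set.\<close>

lemma poly_less_iff_word_diff:
  assumes S: "S \<subseteq> carrier G" "generate G S = carrier G" and f: "poly_less (Suc d) f"
  shows "poly_less d f \<longleftrightarrow> (\<forall>w. set w \<subseteq> S \<and> length w = d \<longrightarrow> word_diff w f = 0)"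
  using f
proof (induction d arbitrary: f)
  case 0
  have const: "f x = f \<one>" if "x \<in> carrier G" for x
  proof -
    have "\<forall>h\<in>carrier G. \<forall>x\<in>carrier G. f (h \<otimes> x) = f x" using 0 by simp
    then have "f (x \<otimes> \<one>) = f \<one>" using that by blast
    then show ?thesis using that by simp
  qed
  have "poly_less 0 f \<longleftrightarrow> f \<one> = 0"
    unfolding deg_less.simps using const by (metis one_closed)
  also have "\<dots> \<longleftrightarrow> (\<forall>w. set w \<subseteq> S \<and> length w = 0 \<longrightarrow> word_diff w f = 0)" by auto
  finally show ?case .
next
  case (Suc d)
  let ?D = "\<lambda>h. poly_less d (left_diff h f)"
  have mult: "?D (g \<otimes> h)" if "?D g" "?D h" "g \<in> carrier G" "h \<in> carrier G" for g h
  proof -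
    have "poly_less d (\<lambda>x. 1 * left_diff g f (h \<otimes> x) + 1 * left_diff h f x)"
      by (rule deg_less_lincomb[OF poly_less_translate[OF that(1,4)] that(2)])
    then show ?thesis
      by (rule deg_less_cong[OF subgroup_self, THEN iffD1, rotated]) (use that in \<open>simp add: m_assoc\<close>)
  qed
  have inv: "?D (inv h)" if "?D h" "h \<in> carrier G" for h
  proof -
    have "poly_less d (\<lambda>x. left_diff h f (inv h \<otimes> x))"
      using that by (intro poly_less_translate) auto
    from deg_less_lincomb[OF this this, of "-1" 0]
    have "poly_less d (\<lambda>x. - 1 * left_diff h f (inv h \<otimes> x) + 0 * left_diff h f (inv h \<otimes> x))" .
    then show ?thesis
      by (rule deg_less_cong[OF subgroup_self, THEN iffD1, rotated]) (use that in simp)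
  qed
  have gen: "?D h" if "\<forall>s\<in>S. ?D s" "h \<in> carrier G" for h
  proof -
    have "h \<in> generate G S" using that(2) S(2) by simp
    then show ?thesis
    proof (induction rule: generate.induct)
      case one
      have "poly_less 0 (left_diff \<one> f)" by simp
      then show ?case by (rule deg_less_mono[OF subgroup_self]) simp
    next
      case (eng g h)
      then show ?case using mult S(1) generate_in_carrier by blast
    qed (use that S(1) inv in auto)
  qed
  have "poly_less (Suc d) f \<longleftrightarrow> (\<forall>s\<in>S. ?D s)"
    using gen S(1) by auto
  also have "\<dots> \<longleftrightarrow> (\<forall>s\<in>S. \<forall>w. set w \<subseteq> S \<and> length w = d \<longrightarrow> word_diff (s # w) f = 0)"
    unfolding word_diff.simps
  proof (rule ball_cong)
    fix s assume "s \<in> S"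
    then have "poly_less (Suc d) (left_diff s f)"
      using Suc.prems S(1) by (auto simp only: deg_less.simps(2)[of _ "Suc d"])
    then show "?D s \<longleftrightarrow> (\<forall>w. set w \<subseteq> S \<and> length w = d \<longrightarrow> word_diff w (left_diff s f) = 0)"
      by (rule Suc.IH)
  qed simp
  also have "\<dots> \<longleftrightarrow> (\<forall>w. set w \<subseteq> S \<and> length w = Suc d \<longrightarrow> word_diff w f = 0)"
    by (auto simp del: word_diff.simps simp: length_Suc_conv)
  finally show ?case .
qed

text \<open>The degree filtration is visible in the basis: for a member of degree at most \<open>j\<close>, the
  polynomials of degree less than \<open>j\<close> are combinations of members that come before it.\<close>

definition adapted_basis :: "nat \<Rightarrow> nat \<Rightarrow> (nat \<Rightarrow> 'a \<Rightarrow> int) \<Rightarrow> bool"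
  where "adapted_basis d n b \<longleftrightarrow> function_basis (carrier G) n b (poly_less d) \<and>
    n > 0 \<and> b 0 = (\<lambda>_. 1) \<and>
    (\<forall>i. 0 < i \<and> i < n \<longrightarrow>
      (\<exists>j k. k \<le> i \<and> poly_less (Suc j) (b i) \<and> function_basis (carrier G) k b (poly_less j)))"

lemma adapted_basis_exists:
  assumes S: "finite S" "S \<subseteq> carrier G" "generate G S = carrier G"
  shows "\<exists>n b. adapted_basis (Suc d) n b"
proof (induction d)
  case 0
  have const: "f x = f \<one>" if "poly_less (Suc 0) f" "x \<in> carrier G" for f x
  proof -
    have "\<forall>h\<in>carrier G. \<forall>x\<in>carrier G. f (h \<otimes> x) = f x" using that(1) by simp
    then have "f (x \<otimes> \<one>) = f \<one>" using that(2) by blast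
    then show ?thesis using that by simp
  qed
  have "function_basis (carrier G) 1 (\<lambda>_ _. 1) (poly_less (Suc 0))"
    unfolding function_basis_def
  proof (intro conjI allI impI)
    fix f assume f: "poly_less (Suc 0) f"
    have "f x = (\<Sum>i<1::nat. f \<one> * 1)" if "x \<in> carrier G" for x
      unfolding const[OF f that] by simp
    then show "\<exists>c. \<forall>x\<in>carrier G. f x = (\<Sum>i<1::nat. c i * 1)"
      by (intro exI[of _ "\<lambda>_. f \<one>"] ballI)
  next
    fix c :: "nat \<Rightarrow> int" and i :: nat
    assume c: "\<forall>x\<in>carrier G. (\<Sum>i<1::nat. c i * 1) = 0" and "i < 1"
    from bspec[OF c one_closed] show "c i = 0" using \<open>i < 1\<close> by simp
  next
    show "poly_less (Suc 0) (\<lambda>_. 1)" by simp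
  qed
  then have "adapted_basis (Suc 0) 1 (\<lambda>_ _. 1)" unfolding adapted_basis_def by simp
  then show ?case by blast
next
  case (Suc d)
  then obtain n b where nb: "adapted_basis (Suc d) n b" by blast
  let ?W = "{w. set w \<subseteq> S \<and> length w = Suc d}"
  have "finite ?W" by (rule finite_lists_length_eq[OF S(1)])
  from finite_list[OF this] obtain ws where ws: "set ws = ?W" by blast
  have eq: "poly_less (Suc d) =
      (\<lambda>f. poly_less (Suc (Suc d)) f \<and> (\<forall>l\<in>set (map word_diff ws). l f = 0))"
  proof (rule ext)
    fix f
    have W: "(\<forall>l\<in>set (map word_diff ws). l f = 0) \<longleftrightarrow>
        (\<forall>w. set w \<subseteq> S \<and> length w = Suc d \<longrightarrow> word_diff w f = 0)"
      by (simp add: ws)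
    show "poly_less (Suc d) f \<longleftrightarrow>
        poly_less (Suc (Suc d)) f \<and> (\<forall>l\<in>set (map word_diff ws). l f = 0)"
      unfolding W using poly_less_iff_word_diff[OF S(2,3), of "Suc d" f]
        deg_less_Suc[OF subgroup_self, of "Suc d" f] by argo
  qed
  have fn: "\<forall>l\<in>set (map word_diff ws). functional_on (carrier G) l"
  proof
    fix l assume "l \<in> set (map word_diff ws)"
    then obtain w where "w \<in> ?W" "l = word_diff w" unfolding set_map ws by blast
    then show "functional_on (carrier G) l" using word_diff_functional[of w] S(2) by auto
  qed
  have old: "function_basis (carrier G) n b (poly_less (Suc d))"
    using nb unfolding adapted_basis_def by blast
  then obtain n' b' where n': "n \<le> n'" and b': "\<forall>i<n. b' i = b i"
    and basis: "function_basis (carrier G) n' b' (poly_less (Suc (Suc d)))"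
    using function_basis_extend[OF deg_less_lincomb fn old[unfolded eq]] by blast
  have transfer: "function_basis (carrier G) k b' P" if "function_basis (carrier G) k b P" "k \<le> n" for k P
    by (rule function_basis_cong[THEN iffD1, OF _ that(1)]) (use b' that(2) in simp)
  have "\<exists>j k. k \<le> i \<and> poly_less (Suc j) (b' i) \<and> function_basis (carrier G) k b' (poly_less j)"
    if i: "0 < i" "i < n'" for i
  proof (cases "i < n")
    case True
    then obtain j k where jk: "k \<le> i" "poly_less (Suc j) (b i)" "function_basis (carrier G) k b (poly_less j)"
      using nb i(1) unfolding adapted_basis_def by blast
    moreover have "b' i = b i" using b' True by blast
    moreover have "function_basis (carrier G) k b' (poly_less j)"
      by (rule transfer[OF jk(3)]) (use jk(1) True in simp)
    ultimately show ?thesis by metis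
  next
    case False
    then have "n \<le> i" by simp
    then show ?thesis
      using transfer[OF old order_refl] function_basis_member[OF basis i(2)] by blast
  qed
  moreover have "b' 0 = (\<lambda>_. 1)" "n' > 0"
    using nb b' n' unfolding adapted_basis_def by auto
  ultimately have "adapted_basis (Suc (Suc d)) n' b'"
    unfolding adapted_basis_def using basis by blast
  then show ?case by blast
qed

section \<open>The right regular representation on polynomials\<close>

text \<open>Left differences commute with right translations. So a right translation acts trivially
  on the quotients of the degree filtration.\<close>

lemma poly_less_right_diff:
  assumes "poly_less (Suc d) f" and g: "g \<in> carrier G"
  shows "poly_less d (\<lambda>x. f (x \<otimes> g) - f x)"
  using assms(1)
proof (induction d arbitrary: f)
  case 0
  have "f (x \<otimes> g) - f x = 0" if x: "x \<in> carrier G" for x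
  proof -
    have "\<forall>h\<in>carrier G. \<forall>x\<in>carrier G. f (h \<otimes> x) = f x" using 0 by simp
    then have "f (x \<otimes> g \<otimes> inv x \<otimes> x) = f x" using x g by blast
    then show ?thesis using x g by (simp add: m_assoc)
  qed
  then show ?case by simp
next
  case (Suc d)
  show ?case
    unfolding deg_less.simps(2)[of _ d]
  proof
    fix h assume h: "h \<in> carrier G"
    have "poly_less (Suc d) (left_diff h f)"
      using Suc.prems h unfolding deg_less.simps(2)[of _ "Suc d"] by blast
    from Suc.IH[OF this]
    show "poly_less d (left_diff h (\<lambda>x. f (x \<otimes> g) - f x))"
      by (rule deg_less_cong[OF subgroup_self, THEN iffD1, rotated]) (use h g in \<open>simp add: m_assoc\<close>)
  qed
qed

text \<open>The left differences of \<open>f\<close> have smaller degree and are fixed by the translation. So the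
  shift of \<open>f\<close> has vanishing left differences, which makes it constant.\<close>

lemma right_diff_constant:
  assumes fix_lower: "\<And>u x. poly_less j u \<Longrightarrow> x \<in> carrier G \<Longrightarrow> u (x \<otimes> g) = u x"
    and f: "poly_less (Suc j) f" and g: "g \<in> carrier G" and x: "x \<in> carrier G"
  shows "f (x \<otimes> g) - f x = f g - f \<one>"
proof -
  have "poly_less j (left_diff x f)" using f x by simp
  from fix_lower[OF this, of \<one>] show ?thesis using g x by simp
qed

text \<open>The matrices of the right regular representation with respect to an adapted basis. The last
  property makes the resulting affine action essentially free. Let row \<open>i\<close> be the first that
  is not a row of the identity matrix. Then the translation by \<open>g\<close> fixes all earlier members of
  the basis, hence all polynomials of degree less than that of \<open>b i\<close>, so it can only add a
  constant to \<open>b i\<close>.\<close>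

lemma unitriangular_representation:
  assumes basis: "adapted_basis d n b"
    and sep: "\<And>g. \<lbrakk>g \<in> carrier G; g \<noteq> \<one>\<rbrakk> \<Longrightarrow> \<exists>f. poly_less d f \<and> f g \<noteq> f \<one>"
  obtains A :: "'a \<Rightarrow> nat \<Rightarrow> nat \<Rightarrow> int" where
    "\<And>g i. \<lbrakk>g \<in> carrier G; i < n\<rbrakk> \<Longrightarrow> A g i i = 1" and
    "\<And>g i j. \<lbrakk>g \<in> carrier G; i < n; i < j\<rbrakk> \<Longrightarrow> A g i j = 0" and
    "\<And>g h i k. \<lbrakk>g \<in> carrier G; h \<in> carrier G; i < n; k < n\<rbrakk> \<Longrightarrow>
      A (g \<otimes> h) i k = (\<Sum>j<n. A g i j * A h j k)" and
    "\<And>i k. \<lbrakk>i < n; k < n\<rbrakk> \<Longrightarrow> A \<one> i k = of_bool (i = k)" and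
    "\<And>g. \<lbrakk>g \<in> carrier G; g \<noteq> \<one>\<rbrakk> \<Longrightarrow> \<exists>i c. 0 < i \<and> i < n \<and> c \<noteq> 0 \<and>
      (\<forall>j<i. \<forall>k<n. A g j k = of_bool (j = k)) \<and>
      (\<forall>k<n. A g i k = of_bool (i = k) + c * of_bool (k = 0))"
proof -
  have fb: "function_basis (carrier G) n b (poly_less d)" and n: "n > 0" and b0: "b 0 = (\<lambda>_. 1)"
    and lower: "\<And>i. 0 < i \<Longrightarrow> i < n \<Longrightarrow> \<exists>j k. k \<le> i \<and> poly_less (Suc j) (b i) \<and>
      function_basis (carrier G) k b (poly_less j)"
    using basis unfolding adapted_basis_def by auto
  note unique = function_basis_unique[OF fb]
  have delta: "(\<Sum>l<n. of_bool (i = l) * b l x) = b i x" if "i < n" for i x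
    using that by (simp add: of_bool_def if_distrib[of "\<lambda>a. a * _"] cong: if_cong)
  define row where "row g i a \<longleftrightarrow> a i = 1 \<and> (\<forall>l>i. a l = 0) \<and>
    (\<forall>x\<in>carrier G. b i (x \<otimes> inv g) = (\<Sum>l<n. a l * b l x))" for g i and a :: "nat \<Rightarrow> int"
  \<comment> \<open>The coefficients of a translate; the translation by the inverse makes the matrices
    multiplicative instead of antimultiplicative.\<close>
  have row_ex: "\<exists>a. row g i a" if g: "g \<in> carrier G" and i: "i < n" for g i
  proof (cases "i = 0")
    case True
    then show ?thesis
      using delta[OF i] b0 unfolding row_def by (intro exI[of _ "\<lambda>l. of_bool (i = l)"]) auto
  next
    case False
    then obtain j k where k: "k \<le> i" and bi: "poly_less (Suc j) (b i)"
      and fbk: "function_basis (carrier G) k b (poly_less j)"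
      using lower i by blast
    obtain c where c: "\<And>x. x \<in> carrier G \<Longrightarrow> b i (x \<otimes> inv g) - b i x = (\<Sum>l<k. c l * b l x)"
      using function_basis_span[OF fbk poly_less_right_diff[OF bi, of "inv g"]] g by auto
    define a where "a l = of_bool (i = l) + (if l < k then c l else 0)" for l
    have "(\<Sum>l<n. a l * b l x) = b i x + (\<Sum>l<k. c l * b l x)" for x
    proof -
      have "(\<Sum>l<n. (if l < k then c l else 0) * b l x) = (\<Sum>l<k. c l * b l x)"
        by (rule sum.mono_neutral_cong_right) (use k i in auto)
      then show ?thesis
        using delta[OF i] by (simp add: a_def distrib_right sum.distrib)
    qed
    then have "row g i a"
      unfolding row_def using c k by (simp add: a_def algebra_simps)
    then show ?thesis by blast
  qed
  define A where "A g i = (SOME a. row g i a)" for g i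
  have A: "row g i (A g i)" if "g \<in> carrier G" "i < n" for g i
    unfolding A_def using row_ex[OF that] by (rule someI_ex)
  have Ab: "b i (x \<otimes> inv g) = (\<Sum>l<n. A g i l * b l x)"
    if "g \<in> carrier G" "i < n" "x \<in> carrier G" for g i x
    using A[OF that(1,2)] that(3) unfolding row_def by blast
  have mult: "A (g \<otimes> h) i k = (\<Sum>j<n. A g i j * A h j k)"
    if g: "g \<in> carrier G" and h: "h \<in> carrier G" and i: "i < n" and k: "k < n" for g h i k
  proof (rule unique[OF _ k])
    fix x assume x: "x \<in> carrier G"
    have "(\<Sum>k<n. A (g \<otimes> h) i k * b k x) = b i (x \<otimes> inv h \<otimes> inv g)"
      using Ab[of "g \<otimes> h" i x] g h i x by (simp add: word_simps)
    also have "\<dots> = (\<Sum>j<n. A g i j * (\<Sum>k<n. A h j k * b k x))"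
      using Ab g h i x by simp
    also have "\<dots> = (\<Sum>j<n. \<Sum>k<n. A g i j * A h j k * b k x)"
      by (simp add: sum_distrib_left mult.assoc)
    also have "\<dots> = (\<Sum>k<n. \<Sum>j<n. A g i j * A h j k * b k x)"
      by (rule sum.swap)
    also have "\<dots> = (\<Sum>k<n. (\<Sum>j<n. A g i j * A h j k) * b k x)"
      by (simp add: sum_distrib_right)
    finally show "(\<Sum>k<n. A (g \<otimes> h) i k * b k x) = (\<Sum>k<n. (\<Sum>j<n. A g i j * A h j k) * b k x)" .
  qed
  have fixed: "A g i k = of_bool (i = k)"
    if "g \<in> carrier G" "i < n" "k < n" "\<And>x. x \<in> carrier G \<Longrightarrow> b i (x \<otimes> inv g) = b i x" for g i k
    by (rule unique[OF _ that(3)]) (use that Ab[of g i] delta in simp)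
  have free: "\<exists>i c. 0 < i \<and> i < n \<and> c \<noteq> 0 \<and>
      (\<forall>j<i. \<forall>k<n. A g j k = of_bool (j = k)) \<and>
      (\<forall>k<n. A g i k = of_bool (i = k) + c * of_bool (k = 0))"
    if g: "g \<in> carrier G" "g \<noteq> \<one>" for g
  proof -
    define moved where "moved i \<longleftrightarrow> i < n \<and> (\<exists>x\<in>carrier G. b i (x \<otimes> inv g) \<noteq> b i x)" for i
    have "\<exists>i. moved i"
    proof (rule ccontr)
      assume "\<nexists>i. moved i"
      then have b_fix: "b i (x \<otimes> inv g) = b i x" if "i < n" "x \<in> carrier G" for i x
        using that by (auto simp: moved_def)
      obtain f where f: "poly_less d f" "f g \<noteq> f \<one>" using sep g by blast
      then obtain c where c: "\<And>x. x \<in> carrier G \<Longrightarrow> f x = (\<Sum>i<n. c i * b i x)"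
        using function_basis_span[OF fb] by blast
      have "f (g \<otimes> inv g) = f g"
        using c[of g] c[of "g \<otimes> inv g"] g(1) b_fix[of _ g] by simp
      then show False using f(2) g(1) by simp
    qed
    then obtain i where i: "moved i" and least: "\<And>j. j < i \<Longrightarrow> \<not> moved j"
      using exists_least_iff[of moved] by blast
    have "i < n" using i by (simp add: moved_def)
    have "i > 0" using i b0 by (cases i) (auto simp: moved_def)
    obtain j k where k: "k \<le> i" and bi: "poly_less (Suc j) (b i)"
      and fbk: "function_basis (carrier G) k b (poly_less j)"
      using lower \<open>i < n\<close> \<open>i > 0\<close> by blast
    have b_fix: "b l (x \<otimes> inv g) = b l x" if "l < i" "x \<in> carrier G" for l x
      using least[OF that(1)] that \<open>i < n\<close> by (auto simp: moved_def)
    have "u (x \<otimes> inv g) = u x" if u: "poly_less j u" and x: "x \<in> carrier G" for u x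
    proof -
      obtain c where c: "\<And>x. x \<in> carrier G \<Longrightarrow> u x = (\<Sum>l<k. c l * b l x)"
        using function_basis_span[OF fbk u] by blast
      show ?thesis
        using c[of x] c[of "x \<otimes> inv g"] x g(1) b_fix[of _ x] k by simp
    qed
    from right_diff_constant[OF this bi]
    have "b i (x \<otimes> inv g) - b i x = b i (inv g) - b i \<one>" if "x \<in> carrier G" for x
      using that g(1) by simp
    then have shift: "b i (x \<otimes> inv g) = b i x + (b i (inv g) - b i \<one>)" if "x \<in> carrier G" for x
      using that by (simp add: algebra_simps)
    let ?c = "b i (inv g) - b i \<one>"
    have "?c \<noteq> 0" using i shift by (auto simp: moved_def)
    moreover have "A g l k = of_bool (l = k)" if "l < i" "k < n" for l k
      using fixed[of g l k] that \<open>i < n\<close> g(1) b_fix by auto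
    moreover have "A g i k = of_bool (i = k) + ?c * of_bool (k = 0)" if "k < n" for k
    proof (rule unique[OF _ that])
      fix x assume x: "x \<in> carrier G"
      have "(\<Sum>k<n. ?c * of_bool (k = 0) * b k x) = ?c * (\<Sum>k<n. of_bool (0 = k) * b k x)"
        unfolding sum_distrib_left mult.assoc by (intro sum.cong) auto
      then have "(\<Sum>k<n. ?c * of_bool (k = 0) * b k x) = ?c"
        using delta[OF n] b0 by simp
      then show "(\<Sum>k<n. A g i k * b k x) = (\<Sum>k<n. (of_bool (i = k) + ?c * of_bool (k = 0)) * b k x)"
        using Ab[OF g(1) \<open>i < n\<close> x] shift[OF x] delta[OF \<open>i < n\<close>]
        by (simp only: distrib_right sum.distrib)
    qed
    ultimately show ?thesis using \<open>i < n\<close> \<open>i > 0\<close> by blast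
  qed
  show thesis
  proof (rule that[of A])
    show "A g i i = 1" if "g \<in> carrier G" "i < n" for g i
      using A[OF that] unfolding row_def by blast
    show "A g i j = 0" if "g \<in> carrier G" "i < n" "i < j" for g i j
      using A[OF that(1,2)] that(3) unfolding row_def by blast
    show "A \<one> i k = of_bool (i = k)" if "i < n" "k < n" for i k
      using that by (intro fixed) auto
  qed (fact mult, fact free)
qed

end

section \<open>Affine actions on ordered abelian groups\<close>

lemma (in group) hom_BijGroupI:
  assumes ext: "\<And>g. g \<in> carrier G \<Longrightarrow> F g \<in> extensional E"
    and closed: "\<And>g x. g \<in> carrier G \<Longrightarrow> x \<in> E \<Longrightarrow> F g x \<in> E"
    and one: "\<And>x. x \<in> E \<Longrightarrow> F \<one> x = x"
    and mult: "\<And>g h x. g \<in> carrier G \<Longrightarrow> h \<in> carrier G \<Longrightarrow> x \<in> E \<Longrightarrow> F (g \<otimes> h) x = F g (F h x)"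
  shows "F \<in> hom G (BijGroup E)"
proof -
  have bij: "F g \<in> Bij E" if g: "g \<in> carrier G" for g
  proof -
    have "bij_betw (F g) E E"
    proof (rule bij_betw_byWitness[where f' = "F (inv g)"])
      show "\<forall>x\<in>E. F (inv g) (F g x) = x" and "\<forall>x\<in>E. F g (F (inv g) x) = x"
        using g one mult[of "inv g" g] mult[of g "inv g"] by simp_all
    qed (use g closed in auto)
    then show ?thesis using ext[OF g] by (simp add: Bij_def)
  qed
  moreover have "F (g \<otimes> h) = compose E (F g) (F h)" if g: "g \<in> carrier G" and h: "h \<in> carrier G" for g h
  proof (rule extensionalityI[of _ E])
    show "F (g \<otimes> h) \<in> extensional E" using ext g h by simp
    show "F (g \<otimes> h) x = compose E (F g) (F h) x" if "x \<in> E" for x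
      using mult[OF g h that] that by (simp add: compose_def)
  qed (rule compose_extensional)
  ultimately show ?thesis
    by (auto simp: hom_def BijGroup_def)
qed

context ordered_comm_group
begin

text \<open>An injective order-preserving homomorphism commutes with the absolute value, and the
  translation part cancels in differences.\<close>

lemma alpha_affine_actionI:
  assumes G: "group G" and \<alpha>: "\<alpha> \<in> hom G (OrdAutoGroup L (\<preceq>))"
    and \<phi>: "\<phi> \<in> hom G (BijGroup (carrier L))"
    and \<nu>: "\<And>g. g \<in> carrier G \<Longrightarrow> \<nu> g \<in> carrier L"
    and affine: "\<And>g x. g \<in> carrier G \<Longrightarrow> x \<in> carrier L \<Longrightarrow> \<phi> g x = \<alpha> g x \<otimes> \<nu> g"
  shows "alpha_affine_action G L (\<preceq>) \<phi> \<alpha>"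
proof -
  have action: "group_action G (carrier L) \<phi>"
    by (intro group_action.intro group_hom.intro group_hom_axioms.intro G group_BijGroup \<phi>)
  have "ord_dist L (\<preceq>) (\<phi> g x) (\<phi> g y) = \<alpha> g (ord_dist L (\<preceq>) x y)"
    if g: "g \<in> carrier G" and x: "x \<in> carrier L" and y: "y \<in> carrier L" for g x y
  proof -
    have "\<alpha> g \<in> carrier (OrdAutoGroup L (\<preceq>))" using \<alpha> g by (auto simp: hom_def)
    then have hom: "\<alpha> g \<in> hom L L" and inj: "inj_on (\<alpha> g) (carrier L)"
      and ord: "order_preserving_on (carrier L) (\<preceq>) (\<alpha> g)"
      by (auto simp: OrdAutoGroup_def auto_def Bij_def bij_betw_def)
    have closed: "\<alpha> g z \<in> carrier L" if "z \<in> carrier L" for z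
      using hom_in_carrier[OF hom that] .
    have diff: "\<phi> g z \<otimes> inv (\<phi> g w) = \<alpha> g (z \<otimes> inv w)" if z: "z \<in> carrier L" and w: "w \<in> carrier L" for z w
    proof -
      have "\<alpha> g (z \<otimes> inv w) = \<alpha> g z \<otimes> inv (\<alpha> g w)"
        using hom_mult[OF hom z, of "inv w"] w group_hom.hom_inv[of L L "\<alpha> g" w] hom
        by (simp add: group_hom_def group_hom_axioms_def is_group)
      moreover have "\<alpha> g z \<otimes> \<nu> g \<otimes> inv (\<alpha> g w \<otimes> \<nu> g) = \<alpha> g z \<otimes> inv (\<alpha> g w)"
        using closed[OF z] closed[OF w] \<nu>[OF g] by (simp add: word_simps)
      ultimately show ?thesis using affine[OF g] z w by simp
    qed
    have iff: "\<alpha> g u \<preceq> \<alpha> g v \<longleftrightarrow> u \<preceq> v" if u: "u \<in> carrier L" and v: "v \<in> carrier L" for u v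
    proof
      assume le: "\<alpha> g u \<preceq> \<alpha> g v"
      show "u \<preceq> v"
      proof (rule ccontr)
        assume "\<not> u \<preceq> v"
        then have "\<alpha> g v \<preceq> \<alpha> g u"
          using le_total[OF u v] ord u v unfolding order_preserving_on_def by blast
        then have "\<alpha> g u = \<alpha> g v"
          using le_antisym le closed u v by blast
        then have "u = v" using inj u v by (simp add: inj_on_eq_iff)
        then show False using \<open>\<not> u \<preceq> v\<close> le_refl u by simp
      qed
    qed (use ord u v in \<open>auto simp: order_preserving_on_def\<close>)
    show ?thesis
      unfolding ord_dist_def Let_def diff[OF x y] diff[OF y x]
      using iff[of "x \<otimes> inv y" "y \<otimes> inv x"] x y by simp
  qed
  then show ?thesis
    by (intro alpha_affine_action.intro alpha_affine_action_axioms.intro action \<alpha> ordered_comm_group_axioms)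
qed

definition moves_up :: "('a \<Rightarrow> 'a) \<Rightarrow> bool"
  where "moves_up f \<longleftrightarrow> (\<forall>x\<in>carrier L. x \<preceq> f x \<and> f x \<noteq> x)"

definition moves_down :: "('a \<Rightarrow> 'a) \<Rightarrow> bool"
  where "moves_down f \<longleftrightarrow> (\<forall>x\<in>carrier L. f x \<preceq> x \<and> f x \<noteq> x)"

text \<open>One of the two end points of a segment is moved out of it.\<close>

lemma segment_not_invariant:
  assumes f: "moves_up f \<or> moves_down f" and ab: "a \<in> carrier L" "b \<in> carrier L"
    and closed: "\<And>x. x \<in> carrier L \<Longrightarrow> f x \<in> carrier L"
  shows "\<not> f ` segment (carrier L) (\<preceq>) a b \<subset> segment (carrier L) (\<preceq>) a b"
proof (cases "a \<preceq> b")
  case True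
  then have "a \<in> segment (carrier L) (\<preceq>) a b" "b \<in> segment (carrier L) (\<preceq>) a b"
    using ab le_refl by (auto simp: segment_def)
  moreover have "\<not> (a \<preceq> f a \<and> f b \<preceq> b)"
    using f
  proof
    assume "moves_up f"
    then have "b \<preceq> f b" "f b \<noteq> b" using ab by (auto simp: moves_up_def)
    then show ?thesis using le_antisym[OF closed[OF ab(2)] ab(2)] by blast
  next
    assume "moves_down f"
    then have "f a \<preceq> a" "f a \<noteq> a" using ab by (auto simp: moves_down_def)
    then show ?thesis using le_antisym[OF closed[OF ab(1)] ab(1)] by blast
  qed
  ultimately show ?thesis unfolding segment_def by blast
next
  case False
  then have "segment (carrier L) (\<preceq>) a b = {}"
    using le_trans[OF ab(1) _ ab(2)] by (auto simp: segment_def)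
  then show ?thesis by simp
qed

lemma rigid_and_hyperbolic_if_moves:
  assumes f: "moves_up f \<or> moves_down f" and bij: "f \<in> Bij (carrier L)"
  shows "rigid_on (carrier L) (\<preceq>) f \<and> hyperbolic_on (carrier L) f"
proof -
  define f' where "f' = inv\<^bsub>BijGroup (carrier L)\<^esub> f"
  have b: "bij_betw f (carrier L) (carrier L)" using bij by (simp add: Bij_def)
  have f': "f' x = inv_into (carrier L) f x" if "x \<in> carrier L" for x
    using that unfolding f'_def inv_BijGroup[OF bij] by simp
  have closed: "f x \<in> carrier L" "f' x \<in> carrier L" "f (f' x) = x" if "x \<in> carrier L" for x
    using that b f' bij_betwE[OF b] bij_betwE[OF bij_betw_inv_into[OF b]] bij_betw_inv_into_right[OF b]
    by auto
  have "moves_up f' \<or> moves_down f'"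
    using f
  proof
    assume up: "moves_up f"
    have "f' x \<preceq> x \<and> f' x \<noteq> x" if "x \<in> carrier L" for x
      using up[unfolded moves_up_def, THEN bspec, OF closed(2)[OF that]] closed(3)[OF that] by auto
    then show ?thesis unfolding moves_down_def by blast
  next
    assume down: "moves_down f"
    have "x \<preceq> f' x \<and> f' x \<noteq> x" if "x \<in> carrier L" for x
      using down[unfolded moves_down_def, THEN bspec, OF closed(2)[OF that]] closed(3)[OF that] by auto
    then show ?thesis unfolding moves_up_def by blast
  qed
  then have "rigid_on (carrier L) (\<preceq>) f"
    unfolding rigid_on_def f'_def[symmetric]
    using segment_not_invariant f closed by blast
  moreover have "hyperbolic_on (carrier L) f"
    using f unfolding hyperbolic_on_def moves_up_def moves_down_def by blast
  ultimately show ?thesis ..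
qed

end

section \<open>Unitriangular affine actions on integer tuples\<close>

text \<open>The matrices \<open>B g\<close> and the vectors \<open>\<nu> g\<close> are the blocks of a representation by
  \<open>(m + 1) \<times> (m + 1)\<close> unitriangular matrices acting on columns with first entry \<open>1\<close>:
  \<open>\<nu> g\<close> is the part of the first column below the diagonal.\<close>

locale unitriangular_affine = group G for G (structure) +
  fixes m :: nat and B :: "'a \<Rightarrow> nat \<Rightarrow> nat \<Rightarrow> int" and \<nu> :: "'a \<Rightarrow> nat \<Rightarrow> int"
  assumes B_diag: "\<lbrakk>g \<in> carrier G; i < m\<rbrakk> \<Longrightarrow> B g i i = 1"
    and B_upper: "\<lbrakk>g \<in> carrier G; i < m; i < j\<rbrakk> \<Longrightarrow> B g i j = 0"
    and B_mult: "\<lbrakk>g \<in> carrier G; h \<in> carrier G; i < m; k < m\<rbrakk> \<Longrightarrow>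
      B (g \<otimes> h) i k = (\<Sum>j<m. B g i j * B h j k)"
    and \<nu>_mult: "\<lbrakk>g \<in> carrier G; h \<in> carrier G; i < m\<rbrakk> \<Longrightarrow>
      \<nu> (g \<otimes> h) i = (\<Sum>j<m. B g i j * \<nu> h j) + \<nu> g i"
    and B_one: "\<lbrakk>i < m; k < m\<rbrakk> \<Longrightarrow> B \<one> i k = of_bool (i = k)"
    and \<nu>_one: "i < m \<Longrightarrow> \<nu> \<one> i = 0"
    and first_moved: "\<lbrakk>g \<in> carrier G; g \<noteq> \<one>\<rbrakk> \<Longrightarrow> \<exists>i<m. \<nu> g i \<noteq> 0 \<and>
      (\<forall>j<i. \<nu> g j = 0) \<and> (\<forall>j\<le>i. \<forall>k<m. B g j k = of_bool (j = k))"
begin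

abbreviation \<Lambda> :: "(nat \<Rightarrow> int) monoid"
  where "\<Lambda> \<equiv> int_tuple_group m"

lemma tuple_carrier: "carrier \<Lambda> = extensional {..<m}"
  by (auto simp: int_tuple_group_def PiE_def)

lemma tuple_mult: "x \<otimes>\<^bsub>\<Lambda>\<^esub> y = (\<lambda>i\<in>{..<m}. x i + y i)"
  by (simp add: int_tuple_group_def)

sublocale ordered: ordered_comm_group \<Lambda> lex_le
  by (rule ordered_comm_group_int_tuple_group)

definition lin :: "'a \<Rightarrow> (nat \<Rightarrow> int) \<Rightarrow> nat \<Rightarrow> int"
  where "lin g = (\<lambda>x\<in>carrier \<Lambda>. \<lambda>i\<in>{..<m}. \<Sum>j<m. B g i j * x j)"

definition aff :: "'a \<Rightarrow> (nat \<Rightarrow> int) \<Rightarrow> nat \<Rightarrow> int"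
  where "aff g = (\<lambda>x\<in>carrier \<Lambda>. lin g x \<otimes>\<^bsub>\<Lambda>\<^esub> (\<lambda>i\<in>{..<m}. \<nu> g i))"

lemma lin_apply: "x \<in> carrier \<Lambda> \<Longrightarrow> i < m \<Longrightarrow> lin g x i = (\<Sum>j<m. B g i j * x j)"
  by (simp add: lin_def)

lemma aff_apply: "x \<in> carrier \<Lambda> \<Longrightarrow> i < m \<Longrightarrow> aff g x i = (\<Sum>j<m. B g i j * x j) + \<nu> g i"
  by (simp add: aff_def tuple_mult lin_apply)

lemma lin_closed: "x \<in> carrier \<Lambda> \<Longrightarrow> lin g x \<in> carrier \<Lambda>"
  by (simp add: lin_def tuple_carrier)

lemma aff_closed: "x \<in> carrier \<Lambda> \<Longrightarrow> aff g x \<in> carrier \<Lambda>"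
  by (simp add: aff_def tuple_mult tuple_carrier)

lemma tuple_eqI:
  assumes "x \<in> carrier \<Lambda>" "y \<in> carrier \<Lambda>" "\<And>i. i < m \<Longrightarrow> x i = y i" shows "x = y"
  using assms unfolding tuple_carrier by (intro extensionalityI[of x "{..<m}" y]) auto

lemma sum_of_bool: "i < m \<Longrightarrow> (\<Sum>j<m. of_bool (i = j) * x j) = (x i :: int)"
  by (simp add: of_bool_def if_distrib[of "\<lambda>a. a * _"] cong: if_cong)

lemma sum_mult_swap:
  "(\<Sum>k<m. (\<Sum>j<m. u j * v j k) * x k) = (\<Sum>j<m. u j * (\<Sum>k<m. v j k * (x k :: int)))"
proof -
  have "(\<Sum>k<m. (\<Sum>j<m. u j * v j k) * x k) = (\<Sum>k<m. \<Sum>j<m. u j * v j k * x k)"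
    by (simp add: sum_distrib_right)
  also have "\<dots> = (\<Sum>j<m. \<Sum>k<m. u j * v j k * x k)" by (rule sum.swap)
  also have "\<dots> = (\<Sum>j<m. u j * (\<Sum>k<m. v j k * x k))" by (simp add: sum_distrib_left mult.assoc)
  finally show ?thesis .
qed

lemma lin_hom_Bij: "lin \<in> hom G (BijGroup (carrier \<Lambda>))"
proof (rule hom_BijGroupI)
  show "lin \<one> x = x" if "x \<in> carrier \<Lambda>" for x
    using that by (intro tuple_eqI lin_closed) (simp_all add: lin_apply B_one sum_of_bool)
  show "lin (g \<otimes> h) x = lin g (lin h x)"
    if "g \<in> carrier G" "h \<in> carrier G" "x \<in> carrier \<Lambda>" for g h x
    using that by (intro tuple_eqI lin_closed) (simp_all add: lin_apply lin_closed B_mult sum_mult_swap)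
qed (simp_all add: lin_closed, simp add: lin_def)

lemma aff_hom_Bij: "aff \<in> hom G (BijGroup (carrier \<Lambda>))"
proof (rule hom_BijGroupI)
  show "aff \<one> x = x" if "x \<in> carrier \<Lambda>" for x
    using that by (intro tuple_eqI aff_closed) (simp_all add: aff_apply B_one \<nu>_one sum_of_bool)
  show "aff (g \<otimes> h) x = aff g (aff h x)"
    if "g \<in> carrier G" "h \<in> carrier G" "x \<in> carrier \<Lambda>" for g h x
  proof (intro tuple_eqI aff_closed that)
    fix i assume i: "i < m"
    have "aff g (aff h x) i = (\<Sum>j<m. B g i j * ((\<Sum>k<m. B h j k * x k) + \<nu> h j)) + \<nu> g i"
      using that i by (simp add: aff_apply aff_closed)
    also have "\<dots> = (\<Sum>j<m. B g i j * (\<Sum>k<m. B h j k * x k)) + (\<Sum>j<m. B g i j * \<nu> h j) + \<nu> g i"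
      by (simp add: distrib_left sum.distrib)
    also have "\<dots> = aff (g \<otimes> h) x i"
      using that i by (simp add: aff_apply B_mult \<nu>_mult sum_mult_swap)
    finally show "aff (g \<otimes> h) x i = aff g (aff h x) i" by simp
  qed
qed (simp_all add: aff_closed, simp add: aff_def)

text \<open>Up to the first coordinate in which two tuples differ, a unitriangular matrix does not
  change the difference.\<close>

lemma lin_mono:
  assumes g: "g \<in> carrier G" and x: "x \<in> carrier \<Lambda>" and y: "y \<in> carrier \<Lambda>" and le: "lex_le x y"
  shows "lex_le (lin g x) (lin g y)"
proof (cases "x = y")
  case False
  then obtain k where k: "x k < y k" "\<And>j. j < k \<Longrightarrow> x j = y j"
    using le unfolding lex_le_def less_fun_def by blast
  have "k < m"
    using k(1) x y unfolding tuple_carrier extensional_def by (cases "k < m") auto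
  have diff: "lin g y i - lin g x i = y i - x i" if "i \<le> k" for i
  proof -
    have "lin g y i - lin g x i = (\<Sum>j<m. B g i j * (y j - x j))"
      using x y that \<open>k < m\<close> by (simp add: lin_apply right_diff_distrib sum_subtractf)
    also have "\<dots> = (\<Sum>j<m. of_bool (i = j) * (y j - x j))"
    proof (intro sum.cong refl)
      fix j assume "j \<in> {..<m}"
      consider "j < i" | "j = i" | "i < j" by linarith
      then show "B g i j * (y j - x j) = of_bool (i = j) * (y j - x j)"
        by cases (use that \<open>k < m\<close> k(2) g B_diag B_upper in simp_all)
    qed
    also have "\<dots> = y i - x i" using that \<open>k < m\<close> by (intro sum_of_bool) simp
    finally show ?thesis .
  qed
  have "lin g x k < lin g y k" using diff[of k] k(1) by simp
  moreover have "lin g x j = lin g y j" if "j < k" for j using diff[of j] k(2)[OF that] that by simp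
  ultimately show ?thesis unfolding lex_le_def less_fun_def by blast
qed (simp add: lex_le_def)

lemma aff_eq_lin_translate:
  "x \<in> carrier \<Lambda> \<Longrightarrow> aff g x = lin g x \<otimes>\<^bsub>\<Lambda>\<^esub> (\<lambda>i\<in>{..<m}. \<nu> g i)"
  by (simp add: aff_def)

lemma lin_hom_OrdAutoGroup: "lin \<in> hom G (OrdAutoGroup \<Lambda> lex_le)"
proof -
  have "lin g \<in> hom \<Lambda> \<Lambda>" for g
  proof (rule homI)
    fix x y assume xy: "x \<in> carrier \<Lambda>" "y \<in> carrier \<Lambda>"
    show "lin g (x \<otimes>\<^bsub>\<Lambda>\<^esub> y) = lin g x \<otimes>\<^bsub>\<Lambda>\<^esub> lin g y"
    proof (intro tuple_eqI)
      fix i assume "i < m"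
      then show "lin g (x \<otimes>\<^bsub>\<Lambda>\<^esub> y) i = (lin g x \<otimes>\<^bsub>\<Lambda>\<^esub> lin g y) i"
        using xy lin_apply[OF ordered.m_closed[OF xy]]
        by (simp add: lin_apply tuple_mult distrib_left sum.distrib)
    qed (use xy lin_closed ordered.m_closed in auto)
  qed (rule lin_closed)
  then show ?thesis
    using lin_hom_Bij lin_mono
    by (auto simp: hom_def OrdAutoGroup_def AutoGroup_def BijGroup_def auto_def order_preserving_on_def)
qed

lemma affine_action: "affine_action G \<Lambda> lex_le aff"
  unfolding affine_action_def
  using ordered.alpha_affine_actionI[OF is_group lin_hom_OrdAutoGroup aff_hom_Bij _ aff_eq_lin_translate]
  by (auto simp: tuple_carrier)

lemma orientation_preserving: "orientation_preserving_action G \<Lambda> lex_le aff"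
  unfolding orientation_preserving_action_def order_preserving_on_def
proof (intro ballI impI)
  fix g x y assume "g \<in> carrier G" "x \<in> carrier \<Lambda>" "y \<in> carrier \<Lambda>" "lex_le x y"
  then show "lex_le (aff g x) (aff g y)"
    unfolding aff_eq_lin_translate[OF \<open>x \<in> carrier \<Lambda>\<close>] aff_eq_lin_translate[OF \<open>y \<in> carrier \<Lambda>\<close>]
    by (intro ordered.le_translate lin_mono lin_closed) (simp_all add: tuple_carrier)
qed

lemma essentially_free: "essentially_free_action G \<Lambda> lex_le aff"
  unfolding essentially_free_action_def
proof (intro ballI impI)
  fix g assume g: "g \<in> carrier G" "g \<noteq> \<one>"
  from first_moved[OF g] obtain i where i: "i < m" "\<nu> g i \<noteq> 0" "\<forall>j<i. \<nu> g j = 0"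
    and B: "\<forall>j\<le>i. \<forall>k<m. B g j k = of_bool (j = k)"
    by blast
  have sum: "aff g x j = x j + \<nu> g j" if "x \<in> carrier \<Lambda>" "j \<le> i" for x j
  proof -
    have "(\<Sum>k<m. B g j k * x k) = (\<Sum>k<m. of_bool (j = k) * x k)"
      using B that(2) by (intro sum.cong) auto
    then show ?thesis using that i(1) sum_of_bool[of j x] by (simp add: aff_apply)
  qed
  have "ordered.moves_up (aff g) \<or> ordered.moves_down (aff g)"
  proof (cases "\<nu> g i > 0")
    case True
    have "less_fun x (aff g x)" if "x \<in> carrier \<Lambda>" for x
      unfolding less_fun_def using sum[OF that] i(3) True by (intro exI[of _ i]) simp
    then show ?thesis
      unfolding ordered.moves_up_def lex_le_def using less_fun_irrefl by fastforce
  next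
    case False
    have "less_fun (aff g x) x" if "x \<in> carrier \<Lambda>" for x
      unfolding less_fun_def using sum[OF that] i(2,3) False by (intro exI[of _ i]) simp
    then show ?thesis
      unfolding ordered.moves_down_def lex_le_def using less_fun_irrefl by fastforce
  qed
  moreover have "aff g \<in> Bij (carrier \<Lambda>)"
    using aff_hom_Bij g(1) by (auto simp: hom_def BijGroup_def)
  ultimately show "rigid_on (carrier \<Lambda>) lex_le (aff g) \<and> hyperbolic_on (carrier \<Lambda>) (aff g)"
    by (rule ordered.rigid_and_hyperbolic_if_moves)
qed

end

theorem theorem0p1:
  fixes G :: "('g, 'b) monoid_scheme"
  assumes "finitely_generated_group G"
    and "torsion_free_group G"
    and "nilpotent_group G"
  shows "\<exists>m::nat. \<exists>\<phi>.
    affine_action G (int_tuple_group m) lex_le \<phi> \<and>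
    orientation_preserving_action G (int_tuple_group m) lex_le \<phi> \<and>
    essentially_free_action G (int_tuple_group m) lex_le \<phi>"
proof -
  interpret group G using assms(2) unfolding torsion_free_group_def by blast
  obtain S where S: "finite S" "S \<subseteq> carrier G" "generate G S = carrier G"
    using assms(1) unfolding finitely_generated_group_def by blast
  obtain c where nil: "lower_central G c = {\<one>\<^bsub>G\<^esub>}"
    using assms(3) unfolding nilpotent_group_def by blast
  have tf: "x = \<one>\<^bsub>G\<^esub>" if "x \<in> carrier G" "n > 0" "x [^]\<^bsub>G\<^esub> (n::nat) = \<one>\<^bsub>G\<^esub>" for x n
    using assms(2) that unfolding torsion_free_group_def by blast
  have "poly_infinite_cyclic (carrier G)"
    by (rule poly_infinite_cyclic_of_polycyclic[OF nil _ polycyclic_of_nilpotent[OF S nil]]) (rule tf)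
  from polynomials_separate_points[OF nil this]
  obtain d where d: "\<And>g. g \<in> carrier G \<Longrightarrow> g \<noteq> \<one>\<^bsub>G\<^esub> \<Longrightarrow> \<exists>f. poly_less d f \<and> f g \<noteq> f \<one>\<^bsub>G\<^esub>"
    by blast
  obtain n b where basis: "adapted_basis (Suc d) n b"
    using adapted_basis_exists[OF S] by blast
  obtain m where n: "n = Suc m"
    using basis unfolding adapted_basis_def by (metis gr0_implies_Suc)
  have sum_split: "(\<Sum>j<n. u j) = u 0 + (\<Sum>j<m. u (Suc j))" for u :: "nat \<Rightarrow> int"
    unfolding n by (rule sum.lessThan_Suc_shift)
  show ?thesis
  proof (rule unitriangular_representation[OF basis])
    show "\<exists>f. poly_less (Suc d) f \<and> f g \<noteq> f \<one>\<^bsub>G\<^esub>" if "g \<in> carrier G" "g \<noteq> \<one>\<^bsub>G\<^esub>" for g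
      using d[OF that] deg_less_Suc[OF subgroup_self] by blast
  next
    fix A :: "'g \<Rightarrow> nat \<Rightarrow> nat \<Rightarrow> int"
    assume diag: "\<And>g i. \<lbrakk>g \<in> carrier G; i < n\<rbrakk> \<Longrightarrow> A g i i = 1"
      and upper: "\<And>g i j. \<lbrakk>g \<in> carrier G; i < n; i < j\<rbrakk> \<Longrightarrow> A g i j = 0"
      and mult: "\<And>g h i k. \<lbrakk>g \<in> carrier G; h \<in> carrier G; i < n; k < n\<rbrakk> \<Longrightarrow>
        A (g \<otimes>\<^bsub>G\<^esub> h) i k = (\<Sum>j<n. A g i j * A h j k)"
      and one: "\<And>i k. \<lbrakk>i < n; k < n\<rbrakk> \<Longrightarrow> A \<one>\<^bsub>G\<^esub> i k = of_bool (i = k)"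
      and free: "\<And>g. \<lbrakk>g \<in> carrier G; g \<noteq> \<one>\<^bsub>G\<^esub>\<rbrakk> \<Longrightarrow> \<exists>i c. 0 < i \<and> i < n \<and> c \<noteq> 0 \<and>
        (\<forall>j<i. \<forall>k<n. A g j k = of_bool (j = k)) \<and>
        (\<forall>k<n. A g i k = of_bool (i = k) + c * of_bool (k = 0))"
    have mult': "A (g \<otimes>\<^bsub>G\<^esub> h) i k = A g i 0 * A h 0 k + (\<Sum>j<m. A g i (Suc j) * A h (Suc j) k)"
      if "g \<in> carrier G" "h \<in> carrier G" "i < n" "k < n" for g h i k
      unfolding mult[OF that] by (rule sum_split)
    \<comment> \<open>Coordinate 0 is the coefficient of the constant function. It is fixed at the value 1, so that
      column 0 of the matrices becomes the translation part.\<close>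
    interpret act: unitriangular_affine G m "\<lambda>g i j. A g (Suc i) (Suc j)" "\<lambda>g i. A g (Suc i) 0"
    proof
      fix g assume g: "g \<in> carrier G" "g \<noteq> \<one>\<^bsub>G\<^esub>"
      from free[OF g] obtain i c where ic: "0 < i" "i < n" "c \<noteq> 0"
        and lower: "\<forall>j<i. \<forall>k<n. A g j k = of_bool (j = k)"
        and row: "\<forall>k<n. A g i k = of_bool (i = k) + c * of_bool (k = 0)"
        by blast
      obtain i' where i': "i = Suc i'" using ic(1) gr0_implies_Suc by blast
      have "A g (Suc j) (Suc k) = of_bool (j = k)" if "j \<le> i'" "k < m" for j k
      proof (cases "j = i'")
        case True
        then show ?thesis using row that i' n by simp
      next
        case False
        then show ?thesis using lower that i' n by simp
      qed
      moreover have "A g (Suc i') 0 \<noteq> 0" using ic(3) row i' n by simp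
      moreover have "A g (Suc j) 0 = 0" if "j < i'" for j using lower that i' n by simp
      moreover have "i' < m" using ic(2) i' n by simp
      ultimately show "\<exists>i<m. A g (Suc i) 0 \<noteq> 0 \<and> (\<forall>j<i. A g (Suc j) 0 = 0) \<and>
          (\<forall>j\<le>i. \<forall>k<m. A g (Suc j) (Suc k) = of_bool (j = k))"
        by blast
    qed (use diag upper mult' one n in auto)
    show ?thesis
      using act.affine_action act.orientation_preserving act.essentially_free by blast
  qed
qed

end
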